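(* Let $\mathbb{F}$ be a field and let $G=\mathrm{Sp}_4(\mathbb{F})=\mathrm{Sp}(V)$, where $V$ is a $4$-dimensional non-degenerate symplectic space over $\mathbb{F}$ with hyperbolic basis $\{e_1,f_1,e_2,f_2\}$. Then $\mathrm{Sp}_4(\mathbb{F})$ is the universal completion of the amalgam $$\{S^\pi_1,\ S^\pi_2,\ M^\pi_1,\ S^\pi_{1\,2},\ Q^\pi_{1\,1},\ Q^\pi_{1\,2}\}.$$ Here $S^\pi_{1\,2}\cong\mathrm{Sp}_2(\mathbb{F})\times\mathrm{Sp}_2(\mathbb{F})$ and $Q^\pi_{1\,1}\cong Q^\pi_{1\,2}\cong \mathbb{F}^3\rtimes\mathrm{Sp}_2(\mathbb{F})$.
   Context: Hyperbolic basis: the symplectic form $\mathsf{s}$ satisfies $\mathsf{s}(e_i,e_j)=\mathsf{s}(f_i,f_j)=0$, $\mathsf{s}(e_i,f_j)=\delta_{ij}$. $\mathrm{Sp}(V)$ is the group of linear automorphisms of $V$ preserving $\mathsf{s}$. $S^\pi_1$ is the subgroup of $G$ fixing the vectors $e_2$ and $f_2$ and stabilizing $\langle e_1,f_1\rangle$; $S^\pi_2$ is the subgroup fixing $e_1$ and $f_1$ and stabilizing $\langle e_2,f_2\rangle$; $M^\pi_1$ is the subgroup fixing the vectors $e_1$ and $e_2$. Moreover $S^\pi_{1\,2}=\langle S^\pi_1,S^\pi_2\rangle$, $Q^\pi_{1\,1}=\langle M^\pi_1,S^\pi_1\rangle$, $Q^\pi_{1\,2}=\langle M^\pi_1,S^\pi_2\rangle$.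 The homomorphisms of the amalgam are the inclusions $S^\pi_1,S^\pi_2\to S^\pi_{1\,2}$; $M^\pi_1,S^\pi_1\to Q^\pi_{1\,1}$; $M^\pi_1,S^\pi_2\to Q^\pi_{1\,2}$. Universal completion: the colimit of this diagram of groups, i.e. the group generated by the disjoint union of the groups subject to all relations holding inside each group and the identifications given by the inclusions. "$G$ is the universal completion" means that the canonical homomorphism from the universal completion to $G$ is an isomorphism.
   Formalization: The normal factor F^3 is taken as the Heisenberg group on F x F^2 with product (t,v)(t',v')=(t+t'+<v,v'>,v+v'), since with additive F^3 the claim fails (e.g. for F_3); in characteristic 2 this group is isomorphic to additive F^3. *)

theory Defs
  imports Complex_Main "HOL-Algebra.Generated_Groups" "HOL-Library.Product_Plus"
begin

section \<open>Groups given by generators and relators\<close>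

text \<open>A letter \<open>(True, x)\<close> stands for the generator \<open>x\<close>, and \<open>(False, x)\<close> for its formal inverse.\<close>

type_synonym 'x word = "(bool \<times> 'x) list"

definition words_over :: "'x set \<Rightarrow> 'x word set"
  where "words_over X = lists (UNIV \<times> X)"

text \<open>The value of a word in the group \<open>H\<close>, after sending each generator \<open>x\<close> to \<open>h x\<close>.\<close>

definition word_value :: "('b, 'm) monoid_scheme \<Rightarrow> ('x \<Rightarrow> 'b) \<Rightarrow> 'x word \<Rightarrow> 'b"
  where "word_value H h w =
    foldr (\<lambda>(b, x) y. (if b then h x else inv\<^bsub>H\<^esub> h x) \<otimes>\<^bsub>H\<^esub> y) w \<one>\<^bsub>H\<^esub>"

text \<open>The congruence on words whose classes are the elements of \<open>\<langle>X | r = 1 (r \<in> R)\<rangle>\<close>.\<close>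

inductive_set word_cong :: "'x set \<Rightarrow> 'x word set \<Rightarrow> ('x word \<times> 'x word) set"
  for X :: "'x set" and R :: "'x word set"
  where
    refl: "w \<in> words_over X \<Longrightarrow> (w, w) \<in> word_cong X R"
  | sym: "(v, w) \<in> word_cong X R \<Longrightarrow> (w, v) \<in> word_cong X R"
  | trans: "(u, v) \<in> word_cong X R \<Longrightarrow> (v, w) \<in> word_cong X R \<Longrightarrow> (u, w) \<in> word_cong X R"
  | cancel: "u \<in> words_over X \<Longrightarrow> v \<in> words_over X \<Longrightarrow> x \<in> X
      \<Longrightarrow> (u @ [(b, x), (\<not> b, x)] @ v, u @ v) \<in> word_cong X R"
  | relator: "u \<in> words_over X \<Longrightarrow> v \<in> words_over X \<Longrightarrow> r \<in> R \<Longrightarrow> r \<in> words_over X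
      \<Longrightarrow> (u @ r @ v, u @ v) \<in> word_cong X R"

definition presented_group :: "'x set \<Rightarrow> 'x word set \<Rightarrow> 'x word set monoid"
  where "presented_group X R =
    \<lparr>carrier = words_over X // word_cong X R,
     mult = (\<lambda>C D. \<Union>u\<in>C. \<Union>v\<in>D. word_cong X R `` {u @ v}),
     one = word_cong X R `` {[]}\<rparr>"


section \<open>Universal completion of a diagram of groups\<close>

text \<open>
  A diagram consists of groups \<open>A i\<close> for \<open>i \<in> I\<close> and of homomorphisms
  \<open>\<phi> i j\<close> from \<open>A i\<close> to \<open>A j\<close> for \<open>(i, j) \<in> E\<close>.
  The relators are all words in the letters of a single \<open>A i\<close> with value \<open>1\<close> in \<open>A i\<close>,
  together with the identifications \<open>x = \<phi> i j x\<close>.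
\<close>

definition diagram_generators :: "'i set \<Rightarrow> ('i \<Rightarrow> 'a monoid) \<Rightarrow> ('i \<times> 'a) set"
  where "diagram_generators I A = (SIGMA i:I. carrier (A i))"

definition diagram_relators ::
    "'i set \<Rightarrow> ('i \<Rightarrow> 'a monoid) \<Rightarrow> ('i \<times> 'i) set \<Rightarrow> ('i \<Rightarrow> 'i \<Rightarrow> 'a \<Rightarrow> 'a) \<Rightarrow> ('i \<times> 'a) word set"
  where "diagram_relators I A E \<phi> =
    {w. \<exists>i\<in>I. w \<in> words_over ({i} \<times> carrier (A i)) \<and> word_value (A i) snd w = \<one>\<^bsub>A i\<^esub>}
    \<union> {[(True, (i, x)), (False, (j, \<phi> i j x))] | i j x. (i, j) \<in> E \<and> x \<in> carrier (A i)}"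

definition universal_completion ::
    "'i set \<Rightarrow> ('i \<Rightarrow> 'a monoid) \<Rightarrow> ('i \<times> 'i) set \<Rightarrow> ('i \<Rightarrow> 'i \<Rightarrow> 'a \<Rightarrow> 'a) \<Rightarrow> ('i \<times> 'a) word set monoid"
  where "universal_completion I A E \<phi> =
    presented_group (diagram_generators I A) (diagram_relators I A E \<phi>)"

text \<open>
  The map from the universal completion to \<open>H\<close> induced by a compatible family
  of homomorphisms \<open>\<psi> i\<close> from \<open>A i\<close> to \<open>H\<close>: all words in a class \<open>C\<close> then have the same value.
\<close>

definition canonical_map :: "('b, 'm) monoid_scheme \<Rightarrow> ('i \<Rightarrow> 'a \<Rightarrow> 'b) \<Rightarrow> ('i \<times> 'a) word set \<Rightarrow> 'b"
  where "canonical_map H \<psi> C = the_elem (word_value H (\<lambda>(i, x). \<psi> i x) ` C)"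

definition is_universal_completion ::
    "('b, 'm) monoid_scheme \<Rightarrow> ('i \<Rightarrow> 'a \<Rightarrow> 'b) \<Rightarrow>
     'i set \<Rightarrow> ('i \<Rightarrow> 'a monoid) \<Rightarrow> ('i \<times> 'i) set \<Rightarrow> ('i \<Rightarrow> 'i \<Rightarrow> 'a \<Rightarrow> 'a) \<Rightarrow> bool"
  where "is_universal_completion H \<psi> I A E \<phi> \<longleftrightarrow>
    canonical_map H \<psi> \<in> iso (universal_completion I A E \<phi>) H"


section \<open>Symplectic spaces and groups\<close>

locale symplectic_space = vector_space scale
  for scale :: "'f::field \<Rightarrow> 'v::ab_group_add \<Rightarrow> 'v" +
  fixes s :: "'v \<Rightarrow> 'v \<Rightarrow> 'f"
  assumes linear_left: "Vector_Spaces.linear scale (*) (\<lambda>x. s x y)"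
    and linear_right: "Vector_Spaces.linear scale (*) (\<lambda>y. s x y)"
    and alternating: "s x x = 0"
    and nondegenerate: "(\<And>y. s x y = 0) \<Longrightarrow> x = 0"

locale symplectic_space_4 = symplectic_space scale s
  for scale :: "'f::field \<Rightarrow> 'v::ab_group_add \<Rightarrow> 'v" and s :: "'v \<Rightarrow> 'v \<Rightarrow> 'f" +
  fixes e1 f1 e2 f2 :: 'v
  assumes distinct_basis: "distinct [e1, f1, e2, f2]"
    and independent_basis: "independent {e1, f1, e2, f2}"
    and span_basis: "span {e1, f1, e2, f2} = UNIV"
    and hyperbolic:
      "s e1 e1 = 0" "s e1 e2 = 0" "s e2 e1 = 0" "s e2 e2 = 0"
      "s f1 f1 = 0" "s f1 f2 = 0" "s f2 f1 = 0" "s f2 f2 = 0"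
      "s e1 f1 = 1" "s e1 f2 = 0" "s e2 f1 = 0" "s e2 f2 = 1"

definition Sp :: "('f::field \<Rightarrow> 'v::ab_group_add \<Rightarrow> 'v) \<Rightarrow> ('v \<Rightarrow> 'v \<Rightarrow> 'f) \<Rightarrow> ('v \<Rightarrow> 'v) monoid"
  where "Sp scale s =
    \<lparr>carrier = {g. Vector_Spaces.linear scale scale g \<and> bij g \<and> (\<forall>x y. s (g x) (g y) = s x y)},
     mult = (\<circ>), one = id\<rparr>"

definition scale2 :: "'f::field \<Rightarrow> 'f \<times> 'f \<Rightarrow> 'f \<times> 'f"
  where "scale2 a v = (a * fst v, a * snd v)"

definition form2 :: "'f::field \<times> 'f \<Rightarrow> 'f \<times> 'f \<Rightarrow> 'f"
  where "form2 v w = fst v * snd w - snd v * fst w"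

definition Sp2 :: "('f::field \<times> 'f \<Rightarrow> 'f \<times> 'f) monoid"
  where "Sp2 = Sp scale2 form2"


section \<open>The amalgam\<close>

datatype amalgam_index = S1 | S2 | M1 | S12 | Q11 | Q12

text \<open>
  \<open>S_set scale s e1 f1 e2 f2\<close> is \<open>S\<^sub>1\<close>; exchanging the two
  hyperbolic pairs gives \<open>S\<^sub>2\<close>.
\<close>

definition S_set ::
    "('f::field \<Rightarrow> 'v::ab_group_add \<Rightarrow> 'v) \<Rightarrow> ('v \<Rightarrow> 'v \<Rightarrow> 'f) \<Rightarrow> 'v \<Rightarrow> 'v \<Rightarrow> 'v \<Rightarrow> 'v \<Rightarrow> ('v \<Rightarrow> 'v) set"
  where "S_set scale s e f e' f' =
    {g \<in> carrier (Sp scale s). g e' = e' \<and> g f' = f' \<and>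
       g ` module.span scale {e, f} = module.span scale {e, f}}"

definition M_set ::
    "('f::field \<Rightarrow> 'v::ab_group_add \<Rightarrow> 'v) \<Rightarrow> ('v \<Rightarrow> 'v \<Rightarrow> 'f) \<Rightarrow> 'v \<Rightarrow> 'v \<Rightarrow> ('v \<Rightarrow> 'v) set"
  where "M_set scale s e1 e2 = {g \<in> carrier (Sp scale s). g e1 = e1 \<and> g e2 = e2}"

fun amalgam_set ::
    "('f::field \<Rightarrow> 'v::ab_group_add \<Rightarrow> 'v) \<Rightarrow> ('v \<Rightarrow> 'v \<Rightarrow> 'f) \<Rightarrow> 'v \<Rightarrow> 'v \<Rightarrow> 'v \<Rightarrow> 'v \<Rightarrow>
     amalgam_index \<Rightarrow> ('v \<Rightarrow> 'v) set"
  where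
    "amalgam_set scale s e1 f1 e2 f2 S1 = S_set scale s e1 f1 e2 f2"
  | "amalgam_set scale s e1 f1 e2 f2 S2 = S_set scale s e2 f2 e1 f1"
  | "amalgam_set scale s e1 f1 e2 f2 M1 = M_set scale s e1 e2"
  | "amalgam_set scale s e1 f1 e2 f2 S12 =
       generate (Sp scale s) (S_set scale s e1 f1 e2 f2 \<union> S_set scale s e2 f2 e1 f1)"
  | "amalgam_set scale s e1 f1 e2 f2 Q11 =
       generate (Sp scale s) (M_set scale s e1 e2 \<union> S_set scale s e1 f1 e2 f2)"
  | "amalgam_set scale s e1 f1 e2 f2 Q12 =
       generate (Sp scale s) (M_set scale s e1 e2 \<union> S_set scale s e2 f2 e1 f1)"

definition amalgam_group ::
    "('f::field \<Rightarrow> 'v::ab_group_add \<Rightarrow> 'v) \<Rightarrow> ('v \<Rightarrow> 'v \<Rightarrow> 'f) \<Rightarrow> 'v \<Rightarrow> 'v \<Rightarrow> 'v \<Rightarrow> 'v \<Rightarrow>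
     amalgam_index \<Rightarrow> ('v \<Rightarrow> 'v) monoid"
  where "amalgam_group scale s e1 f1 e2 f2 i =
    (Sp scale s)\<lparr>carrier := amalgam_set scale s e1 f1 e2 f2 i\<rparr>"

definition amalgam_arrows :: "(amalgam_index \<times> amalgam_index) set"
  where "amalgam_arrows =
    {(S1, S12), (S2, S12), (M1, Q11), (S1, Q11), (M1, Q12), (S2, Q12)}"


section \<open>The group \<open>F\<^sup>3 \<rtimes> Sp\<^sub>2(F)\<close>\<close>

definition semidirect_product ::
    "('a, 'm) monoid_scheme \<Rightarrow> ('b, 'n) monoid_scheme \<Rightarrow> ('b \<Rightarrow> 'a \<Rightarrow> 'a) \<Rightarrow> ('a \<times> 'b) monoid"
  where "semidirect_product N H \<theta> =
    \<lparr>carrier = carrier N \<times> carrier H,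
     mult = (\<lambda>(n, h) (n', h'). (n \<otimes>\<^bsub>N\<^esub> \<theta> h n', h \<otimes>\<^bsub>H\<^esub> h')),
     one = (\<one>\<^bsub>N\<^esub>, \<one>\<^bsub>H\<^esub>)\<rparr>"

text \<open>
  The normal factor of \<open>Q\<^sub>1\<^sub>1\<close> consists of the maps
  \<open>f\<^sub>2 \<mapsto> f\<^sub>2 + v + t e\<^sub>2\<close>, \<open>w \<mapsto> w + s(v, w) e\<^sub>2\<close> for \<open>w \<in> \<langle>e\<^sub>1, f\<^sub>1\<rangle>\<close>,
  \<open>e\<^sub>2 \<mapsto> e\<^sub>2\<close>, with \<open>(t, v) \<in> F \<times> F\<^sup>2 = F\<^sup>3\<close>; they compose by the Heisenberg law below.
  In characteristic 2 this group is isomorphic to the additive group \<open>F\<^sup>3\<close>; in all other characteristics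
  it is not abelian, so the group structure on \<open>F\<^sup>3\<close> cannot be taken to be vector addition.
  The group \<open>Sp\<^sub>2(F)\<close> acts on the second component.
\<close>

definition heis3 :: "('f::field \<times> 'f \<times> 'f) monoid"
  where "heis3 =
    \<lparr>carrier = UNIV,
     mult = (\<lambda>(t, v) (t', v'). (t + t' + form2 v v', v + v')),
     one = (0, 0)\<rparr>"

definition heis3_action :: "('f::field \<times> 'f \<Rightarrow> 'f \<times> 'f) \<Rightarrow> 'f \<times> 'f \<times> 'f \<Rightarrow> 'f \<times> 'f \<times> 'f"
  where "heis3_action h = (\<lambda>(t, v). (t, h v))"

end

theory Submission
  imports Defs
begin

text \<open>
  All members of the amalgam are described by stabilizers of basis vectors. Writing \<open>Fix v\<close> for the
  stabilizer of the vector \<open>v\<close> in \<open>Sp(V)\<close>, one has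
  \<open>S\<^sub>1 = Fix e\<^sub>2 \<inter> Fix f\<^sub>2\<close>, \<open>S\<^sub>2 = Fix e\<^sub>1 \<inter> Fix f\<^sub>1\<close>, \<open>M\<^sub>1 = Fix e\<^sub>1 \<inter> Fix e\<^sub>2\<close>,
  \<open>S\<^sub>1\<^sub>2 = S\<^sub>1 S\<^sub>2\<close>, \<open>Q\<^sub>1\<^sub>1 = Fix e\<^sub>2\<close> and \<open>Q\<^sub>1\<^sub>2 = Fix e\<^sub>1\<close>.
  Let \<open>U\<close> be the universal completion and \<open>\<pi>\<close> its canonical map to \<open>Sp(V)\<close>.

  Surjectivity of \<open>\<pi>\<close> is orbit-stabilizer: the image contains the stabilizer of \<open>e\<^sub>2\<close>, and the members
  together move \<open>e\<^sub>2\<close> to every nonzero vector (\<open>Sp_covered\<close>).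

  Injectivity of \<open>\<pi>\<close> amounts to this: \<open>U\<close> acts on the cosets of \<open>Q\<^sub>1\<^sub>1\<close> as \<open>Sp(V)\<close> acts on the nonzero
  vectors. Indeed \<open>Q\<^sub>1\<^sub>1\<close> is mapped injectively by \<open>\<pi>\<close>, so it is enough that an element of \<open>U\<close> whose image fixes
  \<open>e\<^sub>2\<close> lies in \<open>Q\<^sub>1\<^sub>1\<close>. The group \<open>S\<^sub>1\<^sub>2\<close> has three orbits on the nonzero vectors, represented by
  \<open>e\<^sub>2\<close>, \<open>e\<^sub>2 + e\<^sub>1\<close> and \<open>e\<^sub>1\<close>. Choose elements \<open>r\<close> of \<open>U\<close> over isometries that carry \<open>e\<^sub>2\<close> to these
  vectors: \<open>1\<close>, the shear \<open>e\<^sub>2 \<mapsto> e\<^sub>2 + e\<^sub>1\<close> of \<open>Q\<^sub>1\<^sub>2\<close>, and the product of this shear with the inverse of the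
  shear \<open>e\<^sub>1 \<mapsto> e\<^sub>1 + e\<^sub>2\<close> of \<open>Q\<^sub>1\<^sub>1\<close>. The heart of the proof is that the union of the three double cosets
  \<open>S\<^sub>1\<^sub>2 r Q\<^sub>1\<^sub>1\<close> is stable under left multiplication by \<open>M\<^sub>1\<close> (\<open>M_cosets\<close>). As \<open>Q\<^sub>1\<^sub>1\<close> and \<open>Q\<^sub>1\<^sub>2\<close> are
  generated by \<open>M\<^sub>1\<close> together with \<open>S\<^sub>1\<close> or \<open>S\<^sub>2\<close>, this union is then stable under all members and hence
  equal to \<open>U\<close>. If the image of an element of \<open>S\<^sub>1\<^sub>2 r Q\<^sub>1\<^sub>1\<close> fixes \<open>e\<^sub>2\<close>, disjointness of the orbits forces
  \<open>r = 1\<close>, and the element lies in \<open>Q\<^sub>1\<^sub>1\<close> (\<open>cosets_kernel\<close>).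

  The computations in \<open>U\<close> must take place inside groups that are known to map compatibly to \<open>U\<close>. The members
  alone do not suffice, because the second shear and its conjugates have to be commuted past \<open>S\<^sub>2\<close>. But \<open>S\<^sub>1\<^sub>2\<close>
  contains isometries that exchange \<open>e\<^sub>i\<close> and \<open>f\<^sub>i\<close> up to sign, and conjugation by their images extends the
  maps to the stabilizers of \<open>f\<^sub>1\<close> and \<open>f\<^sub>2\<close>; these extensions agree with the given maps on all intersections
  (\<open>amalgam_cocone\<close>). So \<open>U\<close> contains compatible images of \<open>S\<^sub>1\<^sub>2\<close> and of the stabilizers of all four basis vectors, and
  each step finds one of these five groups that contains the two elements in question.

  For the structure of the members, \<open>S\<^sub>1\<^sub>2\<close> is block diagonal for the two hyperbolic planes. An isometry \<open>g\<close> fixing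
  \<open>e\<^sub>1\<close> is determined by its block on \<open>\<langle>e\<^sub>2, f\<^sub>2\<rangle>\<close> and by \<open>g f\<^sub>1 = t e\<^sub>1 + f\<^sub>1 + n\<close> with \<open>n \<in> \<langle>e\<^sub>2, f\<^sub>2\<rangle>\<close>, and
  \<open>(t, n)\<close> multiplies by the Heisenberg law. Exchanging the two hyperbolic pairs turns \<open>Q\<^sub>1\<^sub>2\<close> into \<open>Q\<^sub>1\<^sub>1\<close>.
\<close>

section \<open>Groups given by generators and relators\<close>

lemma words_over_iff: "w \<in> words_over X \<longleftrightarrow> snd ` set w \<subseteq> X"
  unfolding words_over_def lists_eq_set by auto

lemma words_over_append [simp]:
  "u @ v \<in> words_over X \<longleftrightarrow> u \<in> words_over X \<and> v \<in> words_over X"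
  by (auto simp: words_over_iff)

lemma Nil_words_over [simp]: "[] \<in> words_over X"
  by (simp add: words_over_iff)

lemma word_cong_words_over:
  "(u, v) \<in> word_cong X R \<Longrightarrow> u \<in> words_over X \<and> v \<in> words_over X"
  by (induction rule: word_cong.induct) (auto simp: words_over_iff)

lemma word_cong_append_left:
  "(u, v) \<in> word_cong X R \<Longrightarrow> w \<in> words_over X \<Longrightarrow> (w @ u, w @ v) \<in> word_cong X R"
proof (induction rule: word_cong.induct)
  case (cancel u v x b)
  then show ?case using word_cong.cancel[of "w @ u" X v x b R] by simp
next
  case (relator u v r)
  then show ?case using word_cong.relator[of "w @ u" X v r R] by simp
qed (auto intro: word_cong.intros)

lemma word_cong_append_right:
  "(u, v) \<in> word_cong X R \<Longrightarrow> w \<in> words_over X \<Longrightarrow> (u @ w, v @ w) \<in> word_cong X R"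
proof (induction rule: word_cong.induct)
  case (cancel u v x b)
  then show ?case using word_cong.cancel[of u X "v @ w" x b R] by simp
next
  case (relator u v r)
  then show ?case using word_cong.relator[of u X "v @ w" r R] by simp
qed (auto intro: word_cong.intros)

lemma word_cong_append:
  assumes "(u, u') \<in> word_cong X R" "(v, v') \<in> word_cong X R"
  shows "(u @ v, u' @ v') \<in> word_cong X R"
  using assms word_cong_append_right[of u u' X R v] word_cong_append_left[of v v' X R u']
    word_cong_words_over word_cong.trans by blast

definition word_class :: "'x set \<Rightarrow> 'x word set \<Rightarrow> 'x word \<Rightarrow> 'x word set"
  where "word_class X R w = word_cong X R `` {w}"

lemma word_class_eq: "(u, v) \<in> word_cong X R \<Longrightarrow> word_class X R u = word_class X R v"
  by (auto simp: word_class_def intro: word_cong.sym word_cong.trans)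

lemma word_class_relator:
  assumes "r \<in> R" "r \<in> words_over X"
  shows "word_class X R r = word_class X R []"
  using word_cong.relator[of "[]" X "[]" r R] assms by (intro word_class_eq) simp

lemma carrier_presented_group:
  "C \<in> carrier (presented_group X R) \<longleftrightarrow> (\<exists>w \<in> words_over X. C = word_class X R w)"
  by (auto simp: presented_group_def quotient_def word_class_def)

lemma word_class_carrier [simp]:
  "w \<in> words_over X \<Longrightarrow> word_class X R w \<in> carrier (presented_group X R)"
  by (auto simp: carrier_presented_group)

lemma one_presented_group: "\<one>\<^bsub>presented_group X R\<^esub> = word_class X R []"
  by (simp add: presented_group_def word_class_def)

lemma mult_presented_group:
  assumes "u \<in> words_over X" "v \<in> words_over X"
  shows "word_class X R u \<otimes>\<^bsub>presented_group X R\<^esub> word_class X R v = word_class X R (u @ v)"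
proof -
  have "word_class X R (u' @ v') = word_class X R (u @ v)"
    if "(u, u') \<in> word_cong X R" "(v, v') \<in> word_cong X R" for u' v'
    using word_cong_append[OF that] by (intro word_class_eq[symmetric])
  then have "(\<Union>u'\<in>word_class X R u. \<Union>v'\<in>word_class X R v. word_class X R (u' @ v')) =
      (\<Union>u'\<in>word_class X R u. \<Union>v'\<in>word_class X R v. word_class X R (u @ v))"
    by (intro SUP_cong refl) (auto simp: word_class_def)
  moreover have "u \<in> word_class X R u" "v \<in> word_class X R v"
    using assms by (auto simp: word_class_def intro: word_cong.refl)
  ultimately show ?thesis
    by (auto simp: presented_group_def word_class_def)
qed

definition word_inverse :: "'x word \<Rightarrow> 'x word"
  where "word_inverse w = rev (map (\<lambda>(b, x). (\<not> b, x)) w)"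

lemma word_inverse_words_over [simp]: "word_inverse w \<in> words_over X \<longleftrightarrow> w \<in> words_over X"
  by (force simp: words_over_iff word_inverse_def)

lemma word_inverse_cancel:
  "w \<in> words_over X \<Longrightarrow> (word_inverse w @ w, []) \<in> word_cong X R"
proof (induction w)
  case Nil
  then show ?case by (auto simp: word_inverse_def intro: word_cong.refl)
next
  case (Cons a w)
  obtain b x where a: "a = (b, x)" by force
  from Cons.prems have w: "w \<in> words_over X" and x: "x \<in> X"
    by (auto simp: words_over_iff a)
  have "(word_inverse w @ [(\<not> b, x), (\<not> \<not> b, x)] @ w, word_inverse w @ w) \<in> word_cong X R"
    by (rule word_cong.cancel) (use w x in auto)
  then show ?case
    using Cons.IH[OF w] by (auto simp: word_inverse_def a intro: word_cong.trans)
qed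

lemma group_presented_group: "group (presented_group X R)" (is "group ?U")
proof (rule groupI)
  show "x \<otimes>\<^bsub>?U\<^esub> y \<in> carrier ?U" if "x \<in> carrier ?U" "y \<in> carrier ?U" for x y
    using that by (auto simp: carrier_presented_group mult_presented_group)
next
  show "x \<otimes>\<^bsub>?U\<^esub> y \<otimes>\<^bsub>?U\<^esub> z = x \<otimes>\<^bsub>?U\<^esub> (y \<otimes>\<^bsub>?U\<^esub> z)"
    if "x \<in> carrier ?U" "y \<in> carrier ?U" "z \<in> carrier ?U" for x y z
    using that by (auto simp: carrier_presented_group mult_presented_group)
next
  show "\<one>\<^bsub>?U\<^esub> \<otimes>\<^bsub>?U\<^esub> x = x" if "x \<in> carrier ?U" for x
    using that by (auto simp: carrier_presented_group mult_presented_group one_presented_group)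
next
  fix x assume "x \<in> carrier ?U"
  then obtain w where w: "w \<in> words_over X" "x = word_class X R w"
    by (auto simp: carrier_presented_group)
  then have "word_class X R (word_inverse w) \<otimes>\<^bsub>?U\<^esub> x = \<one>\<^bsub>?U\<^esub>"
    using word_class_eq[OF word_inverse_cancel[OF w(1)]]
    by (simp add: mult_presented_group one_presented_group)
  moreover have "word_class X R (word_inverse w) \<in> carrier ?U" using w by simp
  ultimately show "\<exists>y\<in>carrier ?U. y \<otimes>\<^bsub>?U\<^esub> x = \<one>\<^bsub>?U\<^esub>" by blast
next
  show "\<one>\<^bsub>?U\<^esub> \<in> carrier ?U"
    unfolding one_presented_group by (rule word_class_carrier) simp
qed

lemma word_value_Nil [simp]: "word_value H h [] = \<one>\<^bsub>H\<^esub>"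
  by (simp add: word_value_def)

lemma word_value_Cons [simp]:
  "word_value H h ((b, x) # w) = (if b then h x else inv\<^bsub>H\<^esub> h x) \<otimes>\<^bsub>H\<^esub> word_value H h w"
  by (simp add: word_value_def)

context group
begin

lemma word_value_closed:
  "h ` X \<subseteq> carrier G \<Longrightarrow> w \<in> words_over X \<Longrightarrow> word_value G h w \<in> carrier G"
  by (induction w) (auto simp: words_over_iff image_subset_iff)

lemma word_value_append:
  "h ` X \<subseteq> carrier G \<Longrightarrow> u \<in> words_over X \<Longrightarrow> v \<in> words_over X \<Longrightarrow>
    word_value G h (u @ v) = word_value G h u \<otimes> word_value G h v"
proof (induction u)
  case Nil
  then show ?case by (simp add: word_value_closed)
next
  case (Cons a u)
  obtain b x where a: "a = (b, x)" by force
  from Cons.prems have "u \<in> words_over X" "h x \<in> carrier G"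
    by (auto simp: words_over_iff image_subset_iff a)
  with Cons show ?case
    using word_value_closed[of h X] by (auto simp: a m_assoc)
qed

text \<open>
  Von Dyck's theorem: a map on generators that kills the relators is defined on the presented group.
\<close>

lemma word_value_cong:
  assumes h: "h ` X \<subseteq> carrier G"
    and R: "\<And>r. r \<in> R \<Longrightarrow> r \<in> words_over X \<Longrightarrow> word_value G h r = \<one>"
  shows "(u, v) \<in> word_cong X R \<Longrightarrow> word_value G h u = word_value G h v"
proof (induction rule: word_cong.induct)
  case (cancel u v x b)
  then have x: "h x \<in> carrier G" using h by auto
  have "[(b, x), (\<not> b, x)] \<in> words_over X" using cancel by (simp add: words_over_iff)
  moreover have "word_value G h [(b, x), (\<not> b, x)] = \<one>" using x by simp
  ultimately show ?case using cancel h
    by (simp only: word_value_append[OF h] words_over_append word_value_closed[OF h] l_one)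
next
  case (relator u v r)
  then show ?case
    by (simp add: word_value_append[OF h] word_value_closed[OF h] R)
qed auto

end

section \<open>Maps out of a universal completion\<close>

text \<open>
  A cocone over a diagram of groups, with tip \<open>H\<close>. Its canonical map from the universal completion \<open>U\<close> to \<open>H\<close>
  is a homomorphism, and the maps \<open>generator i\<close> from \<open>A i\<close> to \<open>U\<close> are themselves a cocone.
\<close>

locale diagram_cocone = H: group H
  for H :: "('b, 'm) monoid_scheme" +
  fixes \<psi> :: "'i \<Rightarrow> 'a \<Rightarrow> 'b" and I :: "'i set" and A :: "'i \<Rightarrow> 'a monoid"
    and E :: "('i \<times> 'i) set" and \<phi> :: "'i \<Rightarrow> 'i \<Rightarrow> 'a \<Rightarrow> 'a"
  assumes group_A: "i \<in> I \<Longrightarrow> group (A i)"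
    and hom_\<psi>: "i \<in> I \<Longrightarrow> \<psi> i \<in> hom (A i) H"
    and E_I: "(i, j) \<in> E \<Longrightarrow> i \<in> I \<and> j \<in> I"
    and \<phi>_closed: "(i, j) \<in> E \<Longrightarrow> x \<in> carrier (A i) \<Longrightarrow> \<phi> i j x \<in> carrier (A j)"
    and \<psi>_\<phi>: "(i, j) \<in> E \<Longrightarrow> x \<in> carrier (A i) \<Longrightarrow> \<psi> j (\<phi> i j x) = \<psi> i x"
begin

abbreviation U :: "('i \<times> 'a) word set monoid"
  where "U \<equiv> universal_completion I A E \<phi>"

abbreviation X :: "('i \<times> 'a) set"
  where "X \<equiv> diagram_generators I A"

abbreviation R :: "('i \<times> 'a) word set"
  where "R \<equiv> diagram_relators I A E \<phi>"

definition generator :: "'i \<Rightarrow> 'a \<Rightarrow> ('i \<times> 'a) word set"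
  where "generator i x = word_class X R [(True, (i, x))]"

abbreviation \<psi>' :: "'i \<times> 'a \<Rightarrow> 'b"
  where "\<psi>' \<equiv> \<lambda>(i, x). \<psi> i x"

lemma group_U: "group U"
  unfolding universal_completion_def by (rule group_presented_group)

lemma \<psi>'_closed: "\<psi>' ` X \<subseteq> carrier H"
  using hom_\<psi> by (auto simp: diagram_generators_def hom_def)

lemma word_value_hom:
  assumes "i \<in> I" "w \<in> words_over ({i} \<times> carrier (A i))"
  shows "word_value H \<psi>' w = \<psi> i (word_value (A i) snd w)"
proof -
  interpret A: group "A i" using assms(1) by (rule group_A)
  interpret h: group_hom "A i" H "\<psi> i" by unfold_locales (rule hom_\<psi>[OF assms(1)])
  show ?thesis using assms(2)
  proof (induction w)
    case (Cons a w)
    obtain b x where a: "a = (b, (i, x))" and x: "x \<in> carrier (A i)"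
      and w: "w \<in> words_over ({i} \<times> carrier (A i))"
      using Cons.prems by (cases a) (auto simp: words_over_iff)
    have "word_value (A i) snd w \<in> carrier (A i)"
      using w by (intro A.word_value_closed[of _ "{i} \<times> carrier (A i)"]) auto
    then show ?case using Cons.IH[OF w] x by (simp add: a)
  qed simp
qed

lemma relator_value:
  assumes "r \<in> R" "r \<in> words_over X"
  shows "word_value H \<psi>' r = \<one>\<^bsub>H\<^esub>"
proof -
  from assms(1) consider
    i where "i \<in> I" "r \<in> words_over ({i} \<times> carrier (A i))" "word_value (A i) snd r = \<one>\<^bsub>A i\<^esub>"
    | i j x where "r = [(True, (i, x)), (False, (j, \<phi> i j x))]" "(i, j) \<in> E" "x \<in> carrier (A i)"
    by (auto simp: diagram_relators_def)
  then show ?thesis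
  proof cases
    case 1
    then show ?thesis
      using word_value_hom hom_one[OF hom_\<psi> group_A H.is_group] by simp
  next
    case 2
    then have "\<psi> i x \<in> carrier H" using hom_\<psi>[of i] E_I by (auto simp: hom_def)
    then show ?thesis using 2 by (simp add: \<psi>_\<phi>)
  qed
qed

lemma canonical_map_class:
  assumes "w \<in> words_over X"
  shows "canonical_map H \<psi> (word_class X R w) = word_value H \<psi>' w"
proof -
  have "word_value H \<psi>' v = word_value H \<psi>' w" if "(w, v) \<in> word_cong X R" for v
    using H.word_value_cong[OF \<psi>'_closed relator_value that] by simp
  moreover have "(w, w) \<in> word_cong X R" using assms by (rule word_cong.refl)
  ultimately have "word_value H \<psi>' ` word_class X R w = {word_value H \<psi>' w}"
    unfolding word_class_def by blast
  then show ?thesis by (simp add: canonical_map_def)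
qed

lemma canonical_map_hom: "canonical_map H \<psi> \<in> hom U H"
proof (rule homI)
  fix C assume "C \<in> carrier U"
  then obtain u where u: "u \<in> words_over X" "C = word_class X R u"
    by (auto simp: universal_completion_def carrier_presented_group)
  then show "canonical_map H \<psi> C \<in> carrier H"
    by (simp add: canonical_map_class H.word_value_closed[OF \<psi>'_closed])
  fix D assume "D \<in> carrier U"
  then obtain v where v: "v \<in> words_over X" "D = word_class X R v"
    by (auto simp: universal_completion_def carrier_presented_group)
  from u v show "canonical_map H \<psi> (C \<otimes>\<^bsub>U\<^esub> D) = canonical_map H \<psi> C \<otimes>\<^bsub>H\<^esub> canonical_map H \<psi> D"
    by (simp add: universal_completion_def mult_presented_group canonical_map_class
        H.word_value_append[OF \<psi>'_closed])
qed

lemma letter_words_over: "i \<in> I \<Longrightarrow> x \<in> carrier (A i) \<Longrightarrow> [(b, (i, x))] \<in> words_over X"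
  by (simp add: words_over_iff diagram_generators_def)

lemma generator_closed: "i \<in> I \<Longrightarrow> x \<in> carrier (A i) \<Longrightarrow> generator i x \<in> carrier U"
  by (simp add: generator_def universal_completion_def letter_words_over)

lemma canonical_map_generator:
  assumes "i \<in> I" "x \<in> carrier (A i)"
  shows "canonical_map H \<psi> (generator i x) = \<psi> i x"
  using assms hom_in_carrier[OF hom_\<psi>[OF assms(1)]]
  by (simp add: generator_def canonical_map_class letter_words_over)

lemma inverse_letter:
  assumes "i \<in> I" "x \<in> carrier (A i)"
  shows "word_class X R [(False, (i, x))] = inv\<^bsub>U\<^esub> (generator i x)"
proof -
  have "([] @ [(False, (i, x)), (\<not> False, (i, x))] @ [], [] @ []) \<in> word_cong X R"
    using assms by (intro word_cong.cancel) (auto simp: diagram_generators_def)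
  then have "word_class X R [(False, (i, x)), (True, (i, x))] = word_class X R []"
    by (intro word_class_eq) simp
  then have "word_class X R [(False, (i, x))] \<otimes>\<^bsub>U\<^esub> generator i x = \<one>\<^bsub>U\<^esub>"
    using assms by (simp add: universal_completion_def generator_def mult_presented_group
        letter_words_over one_presented_group)
  moreover have "word_class X R [(False, (i, x))] \<in> carrier U"
    using assms by (simp add: universal_completion_def letter_words_over)
  ultimately show ?thesis
    using assms group.inv_equality[OF group_U] generator_closed by metis
qed

text \<open>
  The word \<open>x y (x y)\<^sup>-\<^sup>1\<close> in the letters of \<open>A i\<close> has value \<open>1\<close> there and so is a relator.
\<close>

lemma generator_hom:
  assumes i: "i \<in> I"
  shows "generator i \<in> hom (A i) U"
proof (rule homI)
  interpret A: group "A i" using i by (rule group_A)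
  interpret U: group U by (rule group_U)
  show "generator i x \<in> carrier U" if "x \<in> carrier (A i)" for x
    using i that by (rule generator_closed)
  fix x y assume x: "x \<in> carrier (A i)" and y: "y \<in> carrier (A i)"
  let ?z = "x \<otimes>\<^bsub>A i\<^esub> y"
  have z: "?z \<in> carrier (A i)" using x y by simp
  let ?r = "[(True, (i, x))] @ [(True, (i, y))] @ [(False, (i, ?z))]"
  have "word_value (A i) snd ?r = \<one>\<^bsub>A i\<^esub>"
    using x y by (simp add: A.m_assoc[symmetric])
  moreover have "?r \<in> words_over ({i} \<times> carrier (A i))"
    using x y by (simp add: words_over_iff)
  ultimately have "?r \<in> R" using i by (auto simp: diagram_relators_def)
  then have "word_class X R ?r = \<one>\<^bsub>U\<^esub>"
    using word_class_relator[of ?r R X] i x y z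
    by (simp add: universal_completion_def one_presented_group letter_words_over
        words_over_iff diagram_generators_def)
  moreover have "word_class X R ?r = generator i x \<otimes>\<^bsub>U\<^esub> (generator i y \<otimes>\<^bsub>U\<^esub> inv\<^bsub>U\<^esub> (generator i ?z))"
    using i x y z
    by (simp add: inverse_letter[symmetric] del: append.simps)
      (simp add: universal_completion_def generator_def mult_presented_group letter_words_over
        words_over_iff diagram_generators_def)
  ultimately show "generator i ?z = generator i x \<otimes>\<^bsub>U\<^esub> generator i y"
    using generator_closed i x y z
    by (metis U.inv_closed U.inv_equality U.inv_inv U.m_assoc U.m_closed)
qed

lemma generator_\<phi>:
  assumes "(i, j) \<in> E" "x \<in> carrier (A i)"
  shows "generator j (\<phi> i j x) = generator i x"
proof -
  interpret U: group U by (rule group_U)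
  have ij: "i \<in> I" "j \<in> I" "\<phi> i j x \<in> carrier (A j)"
    using assms E_I \<phi>_closed by auto
  let ?r = "[(True, (i, x))] @ [(False, (j, \<phi> i j x))]"
  have "?r \<in> R" using assms by (auto simp: diagram_relators_def)
  then have "word_class X R ?r = \<one>\<^bsub>U\<^esub>"
    using word_class_relator[of ?r R X] ij assms
    by (simp add: universal_completion_def one_presented_group words_over_iff
        diagram_generators_def)
  moreover have "word_class X R ?r = generator i x \<otimes>\<^bsub>U\<^esub> inv\<^bsub>U\<^esub> (generator j (\<phi> i j x))"
    using ij assms
    by (simp add: inverse_letter[symmetric] del: append.simps)
      (simp add: universal_completion_def generator_def mult_presented_group letter_words_over)
  ultimately show ?thesis
    using generator_closed ij assms
    by (metis U.inv_closed U.inv_equality U.inv_inv)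
qed

text \<open>
  An inverse letter represents the same element as the letter of the inverse. So every element is a product of
  generators, and a set that contains \<open>1\<close> and is stable under left multiplication by all generators is everything.
\<close>

lemma universal_completion_induct [consumes 1, case_names one mult]:
  assumes "p \<in> carrier U"
    and one: "P \<one>\<^bsub>U\<^esub>"
    and mult: "\<And>i x p. i \<in> I \<Longrightarrow> x \<in> carrier (A i) \<Longrightarrow> p \<in> carrier U \<Longrightarrow> P p \<Longrightarrow> P (generator i x \<otimes>\<^bsub>U\<^esub> p)"
  shows "P p"
proof -
  have "P (word_class X R w)" if "w \<in> words_over X" for w
    using that
  proof (induction w)
    case Nil
    then show ?case using one by (simp add: universal_completion_def one_presented_group)
  next
    case (Cons a w)
    obtain b i x where a: "a = (b, (i, x))" by (metis surj_pair)
    from Cons.prems have i: "i \<in> I" and x: "x \<in> carrier (A i)" and w: "w \<in> words_over X"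
      by (auto simp: words_over_iff a diagram_generators_def)
    interpret A: group "A i" using i by (rule group_A)
    interpret U: group U by (rule group_U)
    interpret h: group_hom "A i" U "generator i"
      by unfold_locales (rule generator_hom[OF i])
    let ?x = "if b then x else inv\<^bsub>A i\<^esub> x"
    have "word_class X R [a] = generator i ?x"
      using i x by (cases b) (simp_all add: a inverse_letter h.hom_inv, simp add: generator_def)
    moreover have "word_class X R (a # w) = word_class X R [a] \<otimes>\<^bsub>U\<^esub> word_class X R w"
      using w i x by (simp add: universal_completion_def mult_presented_group a letter_words_over)
    moreover have "word_class X R w \<in> carrier U"
      using w by (simp add: universal_completion_def)
    ultimately show ?case using mult[OF i, of ?x] Cons.IH[OF w] x by simp
  qed
  then show ?thesis
    using assms(1) by (auto simp: universal_completion_def carrier_presented_group)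
qed

end

section \<open>The symplectic group of a hyperbolic basis\<close>

lemma carrier_Sp:
  "g \<in> carrier (Sp scale s) \<longleftrightarrow>
    Vector_Spaces.linear scale scale g \<and> bij g \<and> (\<forall>x y. s (g x) (g y) = s x y)"
  by (simp add: Sp_def)

lemma mult_Sp [simp]: "g \<otimes>\<^bsub>Sp scale s\<^esub> h = g \<circ> h"
  by (simp add: Sp_def)

lemma one_Sp [simp]: "\<one>\<^bsub>Sp scale s\<^esub> = id"
  by (simp add: Sp_def)

text \<open>
  The prefix \<open>inv\<close> denotes inversion in a group structure, so inverse functions get a name of their own.
\<close>

abbreviation finv :: "('a \<Rightarrow> 'b) \<Rightarrow> 'b \<Rightarrow> 'a"
  where "finv \<equiv> inv_into UNIV"

context vector_space
begin

lemma Sp_comp_closed: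
  assumes "g \<in> carrier (Sp scale s)" "h \<in> carrier (Sp scale s)"
  shows "g \<circ> h \<in> carrier (Sp scale s)"
  using assms Vector_Spaces.linear_compose[of scale scale h scale g] bij_comp[of h g]
  by (simp add: carrier_Sp)

lemma Sp_inv_closed:
  assumes g: "g \<in> carrier (Sp scale s)"
  shows "finv g \<in> carrier (Sp scale s)"
proof -
  have b: "bij g" and lin: "Vector_Spaces.linear scale scale g"
    and s: "\<And>x y. s (g x) (g y) = s x y"
    using g by (auto simp: carrier_Sp)
  have *: "g (finv g x) = x" for x
    using b by (simp add: bij_is_surj surj_f_inv_f)
  have inj: "g x = g y \<Longrightarrow> x = y" for x y
    using b by (simp add: bij_is_inj inj_eq)
  have "finv g (x + y) = finv g x + finv g y" for x y
    by (rule inj) (use lin in \<open>simp add: Vector_Spaces.linear_iff *\<close>)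
  moreover have "finv g (scale a x) = scale a (finv g x)" for a x
    by (rule inj) (use lin in \<open>simp add: Vector_Spaces.linear_iff *\<close>)
  moreover have "s (finv g x) (finv g y) = s x y" for x y
    using s[of "finv g x" "finv g y"] by (simp add: *)
  ultimately show ?thesis
    using b lin by (simp add: carrier_Sp Vector_Spaces.linear_iff bij_imp_bij_inv)
qed

lemma group_Sp: "group (Sp scale s)"
proof (rule groupI)
  fix g assume "g \<in> carrier (Sp scale s)"
  then have "finv g \<in> carrier (Sp scale s)" "finv g \<circ> g = id"
    using Sp_inv_closed by (auto simp: carrier_Sp bij_is_inj)
  then show "\<exists>h\<in>carrier (Sp scale s). h \<otimes>\<^bsub>Sp scale s\<^esub> g = \<one>\<^bsub>Sp scale s\<^esub>"
    by auto
qed (auto simp: Sp_comp_closed o_assoc, auto simp: carrier_Sp Vector_Spaces.linear_iff vector_space_axioms)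

lemma m_inv_Sp:
  assumes "g \<in> carrier (Sp scale s)"
  shows "inv\<^bsub>Sp scale s\<^esub> g = finv g"
  using assms Sp_inv_closed
  by (intro group.inv_equality[OF group_Sp]) (auto simp: carrier_Sp bij_is_inj)

end

context symplectic_space
begin

abbreviation G :: "('v \<Rightarrow> 'v) set"
  where "G \<equiv> carrier (Sp scale s)"

lemma form_left [simp]:
  "s (x + y) z = s x z + s y z" "s (scale a x) z = a * s x z"
  using linear_left[of z] by (simp_all add: Vector_Spaces.linear_iff)

lemma form_right [simp]:
  "s z (x + y) = s z x + s z y" "s z (scale a x) = a * s z x"
  using linear_right[of z] by (simp_all add: Vector_Spaces.linear_iff)

lemma form_zero [simp]: "s 0 z = 0" "s z 0 = 0"
  using form_left(2)[of 0 0 z] form_right(2)[of z 0 0] by simp_all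

lemma form_minus [simp]: "s (- x) z = - s x z" "s z (- x) = - s z x"
  using form_left(1)[of x "- x" z] form_right(1)[of z x "- x"]
  by (simp_all add: eq_neg_iff_add_eq_0 add.commute)

lemma form_diff [simp]: "s (x - y) z = s x z - s y z" "s z (x - y) = s z x - s z y"
  by (simp_all only: diff_conv_add_uminus form_left form_right form_minus)

lemma form_skew: "s x y = - s y x"
  using alternating[of "x + y"] unfolding form_left form_right
  by (simp add: alternating eq_neg_iff_add_eq_0 add.commute)

lemma Sp_add: "g \<in> G \<Longrightarrow> g (x + y) = g x + g y"
  and Sp_scale: "g \<in> G \<Longrightarrow> g (scale a x) = scale a (g x)"
  and Sp_form: "g \<in> G \<Longrightarrow> s (g x) (g y) = s x y"
  by (simp_all add: carrier_Sp Vector_Spaces.linear_iff)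

lemma Sp_zero: "g \<in> G \<Longrightarrow> g 0 = 0"
  using Sp_scale[of g 0 0] by simp

lemma Sp_minus: "g \<in> G \<Longrightarrow> g (- x) = - g x"
  using Sp_scale[of g "- 1" x] by simp

lemma Sp_diff: "g \<in> G \<Longrightarrow> g (x - y) = g x - g y"
  using Sp_add[of g x "- y"] Sp_minus[of g y] by simp

lemmas Sp_linear = Sp_add Sp_scale Sp_zero Sp_minus Sp_diff

lemma Sp_inj: "g \<in> G \<Longrightarrow> g x = g y \<longleftrightarrow> x = y"
  by (auto simp: carrier_Sp bij_def inj_eq)

lemma Sp_inv_left: "g \<in> G \<Longrightarrow> finv g (g x) = x"
  and Sp_inv_right: "g \<in> G \<Longrightarrow> g (finv g x) = x"
  by (simp_all add: carrier_Sp bij_is_inj bij_is_surj surj_f_inv_f)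

lemma Sp_inv_comp: "g \<in> G \<Longrightarrow> finv g \<circ> g = id" "g \<in> G \<Longrightarrow> g \<circ> finv g = id"
  by (auto simp: Sp_inv_left Sp_inv_right)

lemma Sp_inv_eq_iff: "g \<in> G \<Longrightarrow> finv g x = y \<longleftrightarrow> x = g y"
  by (metis Sp_inv_left Sp_inv_right)

lemma id_in_Sp [simp]: "id \<in> G"
  using group.is_monoid[OF group_Sp] monoid.one_closed by fastforce

definition Fix :: "'v \<Rightarrow> ('v \<Rightarrow> 'v) set"
  where "Fix v = {g \<in> G. g v = v}"

lemma Fix_iff: "g \<in> Fix v \<longleftrightarrow> g \<in> G \<and> g v = v"
  by (simp add: Fix_def)

lemma Fix_comp: "g \<in> Fix v \<Longrightarrow> h \<in> Fix v \<Longrightarrow> g \<circ> h \<in> Fix v"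
  by (simp add: Fix_iff Sp_comp_closed)

lemma Fix_inv: "g \<in> Fix v \<Longrightarrow> finv g \<in> Fix v"
  by (simp add: Fix_iff Sp_inv_closed Sp_inv_eq_iff)

lemma subgroup_Sp:
  assumes "K \<subseteq> G" "id \<in> K" "\<And>g h. g \<in> K \<Longrightarrow> h \<in> K \<Longrightarrow> g \<circ> h \<in> K" "\<And>g. g \<in> K \<Longrightarrow> finv g \<in> K"
  shows "subgroup K (Sp scale s)"
  using assms by (intro group.subgroupI[OF group_Sp]) (auto simp: m_inv_Sp subset_iff)

lemma subgroup_Fix: "subgroup (Fix v) (Sp scale s)"
  by (rule subgroup_Sp) (auto simp: Fix_comp Fix_inv, auto simp: Fix_iff)

end

context symplectic_space_4
begin

text \<open>
  Exchanging the two hyperbolic pairs turns statements about \<open>e1\<close> and \<open>f1\<close> into statements about \<open>e2\<close> and \<open>f2\<close>.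
\<close>

lemma swap: "symplectic_space_4 scale s e2 f2 e1 f1"
proof
  have "{e2, f2, e1, f1} = {e1, f1, e2, f2}" by auto
  then show "independent {e2, f2, e1, f1}" "span {e2, f2, e1, f1} = UNIV"
    using independent_basis span_basis by simp_all
qed (use distinct_basis hyperbolic in auto)

lemma hyperbolic_flipped [simp]: "s f1 e1 = - 1" "s f2 e2 = - 1" "s f2 e1 = 0" "s f1 e2 = 0"
  unfolding form_skew[of f1 e1] form_skew[of f2 e2] form_skew[of f2 e1] form_skew[of f1 e2]
  by (simp_all add: hyperbolic)

declare hyperbolic [simp]

text \<open>
  The form reads off the coordinates of a vector, so this is the linear map with prescribed values on the
  hyperbolic basis.
\<close>

definition lin_map :: "'v \<Rightarrow> 'v \<Rightarrow> 'v \<Rightarrow> 'v \<Rightarrow> 'v \<Rightarrow> 'v"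
  where "lin_map E1 F1 E2 F2 v =
    scale (s v f1) E1 + scale (s e1 v) F1 + scale (s v f2) E2 + scale (s e2 v) F2"

lemma linear_lin_map: "Vector_Spaces.linear scale scale (lin_map E1 F1 E2 F2)"
  by (simp add: Vector_Spaces.linear_iff vector_space_axioms lin_map_def algebra_simps)

lemma lin_map_basis [simp]:
  "lin_map E1 F1 E2 F2 e1 = E1" "lin_map E1 F1 E2 F2 f1 = F1"
  "lin_map E1 F1 E2 F2 e2 = E2" "lin_map E1 F1 E2 F2 f2 = F2"
  by (simp_all add: lin_map_def)

lemma basis_expansion:
  "v = scale (s v f1) e1 + scale (s e1 v) f1 + scale (s v f2) e2 + scale (s e2 v) f2"
proof -
  have "v \<in> span {e1, f1, e2, f2}" using span_basis by simp
  then have "v = lin_map e1 f1 e2 f2 v"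
  proof (induction rule: span_induct_alt)
    case base
    then show ?case by (simp add: lin_map_def)
  next
    case (step c x y)
    from \<open>x \<in> {e1, f1, e2, f2}\<close> have "lin_map e1 f1 e2 f2 x = x" by auto
    moreover have "lin_map e1 f1 e2 f2 (scale c x + y) = scale c (lin_map e1 f1 e2 f2 x) + lin_map e1 f1 e2 f2 y"
      using linear_lin_map by (simp add: Vector_Spaces.linear_iff)
    ultimately show ?case using step.IH by simp
  qed
  then show ?thesis by (simp add: lin_map_def)
qed

lemma linear_eq_lin_map:
  assumes "Vector_Spaces.linear scale scale g"
  shows "g = lin_map (g e1) (g f1) (g e2) (g f2)"
proof
  fix v
  show "g v = lin_map (g e1) (g f1) (g e2) (g f2) v"
    unfolding lin_map_def
    by (subst (1) basis_expansion) (use assms in \<open>simp add: Vector_Spaces.linear_iff\<close>)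
qed

lemma Sp_eqI:
  assumes "g \<in> G" "h \<in> G" "g e1 = h e1" "g f1 = h f1" "g e2 = h e2" "g f2 = h f2"
  shows "g = h"
  using assms linear_eq_lin_map[of g] linear_eq_lin_map[of h] by (simp add: carrier_Sp)

lemma form_expansion:
  "s v w = s v f1 * s e1 w - s e1 v * s w f1 + s v f2 * s e2 w - s e2 v * s w f2"
  by (subst basis_expansion[of v]) (simp add: form_skew[of f1 w] form_skew[of f2 w])

text \<open>
  Nondegeneracy makes a form-preserving map injective, and finite dimension then makes it bijective.
\<close>

lemma Sp_if_linear:
  assumes lin: "Vector_Spaces.linear scale scale g" and pres: "\<And>v w. s (g v) (g w) = s v w"
  shows "g \<in> G"
proof -
  interpret fd: finite_dimensional_vector_space scale "{e1, f1, e2, f2}"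
    by unfold_locales (auto simp: independent_basis span_basis)
  have "inj g"
  proof (rule injI)
    fix x y assume "g x = g y"
    then have "s (g x) (g z) = s (g y) (g z)" for z by simp
    then have "s (x - y) z = 0" for z by (simp add: pres)
    then show "x = y" using nondegenerate[of "x - y"] by simp
  qed
  moreover have "surj g"
    using fd.linear_inj_imp_surj[OF lin \<open>inj g\<close>] .
  ultimately show ?thesis using lin pres by (simp add: carrier_Sp bij_def)
qed

lemma lin_map_in_Sp:
  assumes "s E1 F1 = 1" "s E2 F2 = 1" "s E1 E2 = 0" "s E1 F2 = 0" "s F1 E2 = 0" "s F1 F2 = 0"
  shows "lin_map E1 F1 E2 F2 \<in> G"
proof (rule Sp_if_linear[OF linear_lin_map])
  fix v w
  have "s F1 E1 = - 1" "s F2 E2 = - 1" "s E2 E1 = 0" "s F2 E1 = 0" "s E2 F1 = 0" "s F2 F1 = 0"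
    unfolding form_skew[of F1 E1] form_skew[of F2 E2] form_skew[of E2 E1] form_skew[of F2 E1]
      form_skew[of E2 F1] form_skew[of F2 F1]
    by (simp_all add: assms)
  then show "s (lin_map E1 F1 E2 F2 v) (lin_map E1 F1 E2 F2 w) = s v w"
    unfolding form_expansion[of v w]
    by (simp add: assms lin_map_def alternating algebra_simps)
qed

text \<open>
  The groups \<open>S\<^sub>1\<close>, \<open>S\<^sub>2\<close> and \<open>M\<^sub>1\<close> as intersections of vector stabilizers; \<open>L12\<close> below is \<open>S\<^sub>1\<^sub>2\<close>.
\<close>

abbreviation L1 :: "('v \<Rightarrow> 'v) set" where "L1 \<equiv> Fix e2 \<inter> Fix f2"
abbreviation L2 :: "('v \<Rightarrow> 'v) set" where "L2 \<equiv> Fix e1 \<inter> Fix f1"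
abbreviation M :: "('v \<Rightarrow> 'v) set" where "M \<equiv> Fix e1 \<inter> Fix e2"

lemma span_pair: "v \<in> span {e1, f1} \<longleftrightarrow> s v e2 = 0 \<and> s v f2 = 0"
proof
  show "v \<in> span {e1, f1} \<Longrightarrow> s v e2 = 0 \<and> s v f2 = 0"
    by (induction rule: span_induct_alt) auto
  assume "s v e2 = 0 \<and> s v f2 = 0"
  then have "v = scale (s v f1) e1 + scale (s e1 v) f1"
    using basis_expansion[of v] form_skew[of e2 v] by simp
  then show "v \<in> span {e1, f1}"
    by (metis span_add span_scale span_base insertI1 insertI2)
qed

text \<open>
  An isometry that fixes \<open>e2\<close> and \<open>f2\<close> stabilizes the orthogonal complement \<open>\<langle>e1, f1\<rangle>\<close> of these vectors.
\<close>

lemma S_set_eq: "S_set scale s e1 f1 e2 f2 = L1"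
proof -
  have "g ` span {e1, f1} = span {e1, f1}" if g: "g \<in> G" "g e2 = e2" "g f2 = f2" for g
  proof (intro equalityI subsetI)
    have sub: "h v \<in> span {e1, f1}" if "h \<in> G" "h e2 = e2" "h f2 = f2" "v \<in> span {e1, f1}" for h v
      using that Sp_form[of h v e2] Sp_form[of h v f2] by (simp add: span_pair)
    then show "v \<in> span {e1, f1}" if "v \<in> g ` span {e1, f1}" for v
      using that g by auto
    fix v assume v: "v \<in> span {e1, f1}"
    have "finv g v \<in> span {e1, f1}"
      by (rule sub) (use g v in \<open>simp_all add: Sp_inv_closed Sp_inv_eq_iff\<close>)
    then show "v \<in> g ` span {e1, f1}"
      using g by (metis Sp_inv_right imageI)
  qed
  then have "S_set scale s e1 f1 e2 f2 = {g \<in> G. g e2 = e2 \<and> g f2 = f2}"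
    unfolding S_set_def by blast
  then show ?thesis unfolding Fix_def by blast
qed

lemma M_set_eq: "M_set scale s e1 e2 = M"
  unfolding M_set_def Fix_def by blast

lemma ex_L1:
  assumes "a * q - b * p = 1"
  shows "\<exists>g\<in>L1. g e1 = scale a e1 + scale b f1 \<and> g f1 = scale p e1 + scale q f1"
proof
  let ?g = "lin_map (scale a e1 + scale b f1) (scale p e1 + scale q f1) e2 f2"
  have "?g \<in> G" by (rule lin_map_in_Sp) (use assms in \<open>simp_all add: mult.commute\<close>)
  then show "?g \<in> L1" by (simp add: Fix_iff)
qed simp

lemma L1_transitive:
  assumes "a \<noteq> 0 \<or> b \<noteq> 0"
  shows "\<exists>g\<in>L1. g e1 = scale a e1 + scale b f1"
proof (cases "a = 0")
  case True
  then have "a * 0 - b * (- inverse b) = 1" using assms by simp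
  from ex_L1[OF this] show ?thesis by blast
next
  case False
  then have "a * inverse a - b * 0 = 1" by simp
  from ex_L1[OF this] show ?thesis by blast
qed

lemma L1_commute_L2:
  assumes g: "g \<in> L1" and h: "h \<in> L2"
  shows "g \<circ> h = h \<circ> g"
proof -
  have gh: "g \<in> G" "h \<in> G" using assms by (auto simp: Fix_iff)
  have "g v \<in> span {e1, f1}" if "v \<in> {e1, f1}" for v
    using g that Sp_form[OF gh(1), of v e2] Sp_form[OF gh(1), of v f2]
    by (auto simp: span_pair Fix_iff)
  moreover have "h v = v" if "v \<in> span {e1, f1}" for v
    using that h by (induction rule: span_induct_alt) (auto simp: Fix_iff Sp_linear)
  ultimately have 1: "h (g e1) = g e1" "h (g f1) = g f1" by auto
  have "g v = v" if "v \<in> span {e2, f2}" for v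
    using that g by (induction rule: span_induct_alt) (auto simp: Fix_iff Sp_linear)
  moreover have "h v \<in> span {e2, f2}" if "v \<in> {e2, f2}" for v
    using h that Sp_form[OF gh(2), of v e1] Sp_form[OF gh(2), of v f1]
    by (auto simp: symplectic_space_4.span_pair[OF swap] Fix_iff)
  ultimately have 2: "g (h e2) = h e2" "g (h f2) = h f2" by auto
  show ?thesis
    by (rule Sp_eqI) (use g h gh 1 2 in \<open>simp_all add: Sp_comp_closed Fix_iff\<close>)
qed

definition L12 :: "('v \<Rightarrow> 'v) set"
  where "L12 = {g1 \<circ> g2 | g1 g2. g1 \<in> L1 \<and> g2 \<in> L2}"

lemma L12_I: "g1 \<in> L1 \<Longrightarrow> g2 \<in> L2 \<Longrightarrow> g1 \<circ> g2 \<in> L12"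
  by (auto simp: L12_def)

lemma L1_sub_L12: "g \<in> L1 \<Longrightarrow> g \<in> L12"
  using L12_I[of g id] by (simp add: Fix_iff)

lemma L2_sub_L12: "g \<in> L2 \<Longrightarrow> g \<in> L12"
  using L12_I[of id g] by (simp add: Fix_iff)

lemma L12_comp:
  assumes "g \<in> L12" "h \<in> L12"
  shows "g \<circ> h \<in> L12"
proof -
  obtain g1 g2 h1 h2 where *: "g1 \<in> L1" "g2 \<in> L2" "h1 \<in> L1" "h2 \<in> L2" "g = g1 \<circ> g2" "h = h1 \<circ> h2"
    using assms by (auto simp: L12_def)
  have "g \<circ> h = g1 \<circ> (g2 \<circ> h1) \<circ> h2" by (simp add: * comp_assoc)
  also have "g2 \<circ> h1 = h1 \<circ> g2" using L1_commute_L2 * by metis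
  finally have "g \<circ> h = (g1 \<circ> h1) \<circ> (g2 \<circ> h2)" by (simp only: comp_assoc)
  then show ?thesis using * by (metis L12_I Fix_comp IntE IntI)
qed

lemma L12_Sp: "g \<in> L12 \<Longrightarrow> g \<in> G"
  by (auto simp: L12_def Fix_iff Sp_comp_closed)

lemma L12_inv:
  assumes "g \<in> L12"
  shows "finv g \<in> L12"
proof -
  obtain g1 g2 where *: "g1 \<in> L1" "g2 \<in> L2" "g = g1 \<circ> g2"
    using assms by (auto simp: L12_def)
  have "bij g1" "bij g2" using * by (auto simp: Fix_iff carrier_Sp)
  then have "finv g = finv g2 \<circ> finv g1" using * o_inv_distrib by blast
  also have "\<dots> = finv g1 \<circ> finv g2" using L1_commute_L2 * Fix_inv by (metis IntE IntI)
  finally show ?thesis using * L12_I Fix_inv by (metis IntE IntI)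
qed

lemma subgroup_L12: "subgroup L12 (Sp scale s)"
  by (rule subgroup_Sp) (auto simp: L12_comp L12_inv L12_Sp, simp add: L1_sub_L12 Fix_iff)

lemma generate_L12: "generate (Sp scale s) (L1 \<union> L2) = L12"
proof (rule antisym)
  show "generate (Sp scale s) (L1 \<union> L2) \<subseteq> L12"
    using L1_sub_L12 L2_sub_L12
    by (intro group.generate_subgroup_incl[OF group_Sp] subgroup_L12) blast
  show "L12 \<subseteq> generate (Sp scale s) (L1 \<union> L2)"
    unfolding L12_def
  proof clarify
    fix g1 g2 assume g: "g1 \<in> Fix e2" "g1 \<in> Fix f2" "g2 \<in> Fix e1" "g2 \<in> Fix f1"
    then have "g1 \<otimes>\<^bsub>Sp scale s\<^esub> g2 \<in> generate (Sp scale s) (L1 \<union> L2)"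
      by (intro generate.eng generate.incl) auto
    then show "g1 \<circ> g2 \<in> generate (Sp scale s) (L1 \<union> L2)" by simp
  qed
qed

lemma ex_weyl: "\<exists>n\<in>L1. n e1 = f1 \<and> n f1 = - e1"
  using ex_L1[of 0 0 1 "- 1"] by simp

lemma ex_torus: "a \<noteq> 0 \<Longrightarrow> \<exists>d\<in>L1. d e1 = scale a e1 \<and> d f1 = scale (inverse a) f1"
  using ex_L1[of a "inverse a" 0 0] by simp

text \<open>
  The shear carries \<open>e2\<close> to \<open>e2 + e1\<close>; the effect on \<open>f1\<close> is forced by the form. It is a short root element of
  \<open>Fix e1 \<inter> Fix f2\<close>, and \<open>shear12\<close> is its mirror image in \<open>Fix e2 \<inter> Fix f1\<close>.
\<close>

definition shear21 :: "'v \<Rightarrow> 'v"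
  where "shear21 = lin_map e1 (f1 - f2) (e2 + e1) f2"

lemma shear21_Sp [simp]: "shear21 \<in> G"
  unfolding shear21_def by (rule lin_map_in_Sp) simp_all

lemma shear21_basis [simp]: "shear21 e1 = e1" "shear21 f1 = f1 - f2" "shear21 e2 = e2 + e1" "shear21 f2 = f2"
  by (simp_all add: shear21_def)

text \<open>
  The vector \<open>k e2\<close> is orthogonal to \<open>k e1 = e1\<close> and so has no component along \<open>f1\<close>. Its component in
  \<open>\<langle>e2, f2\<rangle>\<close> is nonzero and is produced by \<open>h\<close>; its component \<open>a1 e1\<close> is produced by the shear, rescaled by the torus
  element \<open>d : e1 \<mapsto> a1 e1\<close>. What remains fixes \<open>e2\<close>.
\<close>

lemma Fix_e1_decomposition:
  assumes k: "k \<in> Fix e1"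
  shows "\<exists>h\<in>L2. \<exists>\<mu>\<in>M. k = h \<circ> \<mu> \<or>
    (\<exists>d\<in>L1. d \<circ> shear21 \<circ> finv d \<in> Fix e1 \<and> k = h \<circ> (d \<circ> shear21 \<circ> finv d) \<circ> \<mu>)"
proof -
  have kG: "k \<in> G" "k e1 = e1" using k by (auto simp: Fix_iff)
  define a1 where "a1 = s (k e2) f1"
  define a2 where "a2 = s (k e2) f2"
  define b2 where "b2 = s e2 (k e2)"
  have "s e1 (k e2) = 0" using Sp_form[OF kG(1), of e1 e2] kG by simp
  then have ke2: "k e2 = scale a1 e1 + scale a2 e2 + scale b2 f2"
    using basis_expansion[of "k e2"] by (simp add: a1_def a2_def b2_def)
  have "a2 \<noteq> 0 \<or> b2 \<noteq> 0"
  proof (rule ccontr)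
    assume "\<not> ?thesis"
    then have "k e2 = k (scale a1 e1)" using ke2 kG by (simp add: Sp_linear)
    then have "e2 = scale a1 e1" using Sp_inj kG by blast
    then have "s e2 f2 = s (scale a1 e1) f2" by simp
    then show False by simp
  qed
  then obtain h where h: "h \<in> L2" "h e2 = scale a2 e2 + scale b2 f2"
    using symplectic_space_4.L1_transitive[OF swap] by blast
  have hG: "h \<in> G" "h e1 = e1" using h by (auto simp: Fix_iff)
  have "k e2 = h (scale a1 e1 + e2)" "k e1 = h e1"
    using hG h kG by (simp_all add: ke2 Sp_linear add.assoc)
  then have hk: "(finv h \<circ> k) e2 = scale a1 e1 + e2" "(finv h \<circ> k) e1 = e1" "finv h \<circ> k \<in> G"
    using hG kG by (simp_all add: Sp_inv_left Sp_inv_closed Sp_comp_closed Sp_inv_eq_iff)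
  show ?thesis
  proof (cases "a1 = 0")
    case True
    then have "finv h \<circ> k \<in> M" using hk by (simp add: Fix_iff)
    moreover have "k = h \<circ> (finv h \<circ> k)" using hG by (auto simp: Sp_inv_right)
    ultimately show ?thesis using h by blast
  next
    case False
    then obtain d where d: "d \<in> L1" "d e1 = scale a1 e1" using ex_torus by blast
    let ?x = "d \<circ> shear21 \<circ> finv d"
    have dG: "d \<in> G" "d e2 = e2" using d by (auto simp: Fix_iff)
    have x: "?x \<in> G" using dG by (simp add: Sp_comp_closed Sp_inv_closed)
    have "finv d e1 = scale (inverse a1) e1" "finv d e2 = e2"
      using dG d False by (simp_all add: Sp_inv_eq_iff Sp_linear)
    then have xe: "?x e1 = e1" "?x e2 = scale a1 e1 + e2"
      using dG d False by (simp_all add: Sp_linear add.commute)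
    let ?\<mu> = "finv ?x \<circ> (finv h \<circ> k)"
    have "?\<mu> e1 = e1" "?\<mu> e2 = e2"
      using Sp_inv_eq_iff[OF x] xe hk by (simp_all del: comp_apply add: comp_apply[of "finv ?x"])
    moreover have "?\<mu> \<in> G" using x hk by (simp add: Sp_comp_closed Sp_inv_closed)
    ultimately have "?\<mu> \<in> M" by (simp add: Fix_iff)
    moreover have "k = h \<circ> ?x \<circ> ?\<mu>"
    proof
      fix v
      have "(h \<circ> ?x \<circ> ?\<mu>) v = h (?x (finv ?x (finv h (k v))))" by simp
      then show "k v = (h \<circ> ?x \<circ> ?\<mu>) v"
        by (simp only: Sp_inv_right[OF x] Sp_inv_right[OF hG(1)])
    qed
    moreover have "?x \<in> Fix e1" using x xe by (simp add: Fix_iff)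
    ultimately show ?thesis using h d by blast
  qed
qed

text \<open>
  The only factor in the decomposition of an element of \<open>Fix e1\<close> that is not visibly generated by \<open>M\<close> and
  \<open>L2\<close> is the rescaled shear. It fixes \<open>e1\<close> and \<open>f2\<close>, so an element of \<open>L2\<close> that maps \<open>e2\<close> to \<open>f2\<close> conjugates
  it into \<open>M\<close>.
\<close>

lemma generate_Fix_e1: "generate (Sp scale s) (M \<union> L2) = Fix e1"
proof (rule antisym)
  show "generate (Sp scale s) (M \<union> L2) \<subseteq> Fix e1"
    by (intro group.generate_subgroup_incl[OF group_Sp] subgroup_Fix) auto
  let ?H = "generate (Sp scale s) (M \<union> L2)"
  have incl: "g \<in> ?H" if "g \<in> M \<union> L2" for g
    using that by (rule generate.incl)
  have comp: "g \<circ> h \<in> ?H" if "g \<in> ?H" "h \<in> ?H" for g h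
    using generate.eng[OF that] by simp
  show "Fix e1 \<subseteq> ?H"
  proof
    fix k assume "k \<in> Fix e1"
    then obtain h \<mu> where h: "h \<in> L2" and \<mu>: "\<mu> \<in> M"
      and or: "k = h \<circ> \<mu> \<or>
        (\<exists>d\<in>L1. d \<circ> shear21 \<circ> finv d \<in> Fix e1 \<and> k = h \<circ> (d \<circ> shear21 \<circ> finv d) \<circ> \<mu>)"
      using Fix_e1_decomposition by blast
    from or show "k \<in> ?H"
    proof
      assume "k = h \<circ> \<mu>"
      then show ?thesis using comp incl h \<mu> by simp
    next
      assume "\<exists>d\<in>L1. d \<circ> shear21 \<circ> finv d \<in> Fix e1 \<and> k = h \<circ> (d \<circ> shear21 \<circ> finv d) \<circ> \<mu>"
      then obtain d where d: "d \<in> L1" and dx: "d \<circ> shear21 \<circ> finv d \<in> Fix e1"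
        and k: "k = h \<circ> (d \<circ> shear21 \<circ> finv d) \<circ> \<mu>" by blast
      let ?x = "d \<circ> shear21 \<circ> finv d"
      have x: "?x \<in> G" "?x f2 = f2" "?x e1 = e1"
      proof -
        have dG: "d \<in> G" "d f2 = f2" "d e2 = e2" using d by (auto simp: Fix_iff)
        show "?x \<in> G" using dG by (simp add: Sp_comp_closed Sp_inv_closed)
        have "finv d f2 = f2" using dG by (simp add: Sp_inv_eq_iff)
        then show "?x f2 = f2" using dG by simp
        show "?x e1 = e1" using dx by (simp add: Fix_iff)
      qed
      obtain n where n: "n \<in> L2" "n e2 = f2" "n f2 = - e2"
        using symplectic_space_4.ex_weyl[OF swap] by blast
      have nG: "n \<in> G" "n e1 = e1" using n by (auto simp: Fix_iff)
      have "finv n \<circ> ?x \<circ> n \<in> G" using nG x by (simp add: Sp_comp_closed Sp_inv_closed)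
      moreover have "(finv n \<circ> ?x \<circ> n) e1 = e1" "(finv n \<circ> ?x \<circ> n) e2 = e2"
        using n nG x by (simp_all add: Sp_inv_eq_iff)
      ultimately have "finv n \<circ> ?x \<circ> n \<in> M" by (simp add: Fix_iff)
      moreover have "finv n \<in> L2" using n Fix_inv by blast
      moreover have "?x = n \<circ> (finv n \<circ> ?x \<circ> n) \<circ> finv n"
        using nG by (auto simp: Sp_inv_right)
      ultimately have "?x \<in> ?H" using comp incl n by (metis UnI1 UnI2)
      then show ?thesis using k comp incl h \<mu> by simp
    qed
  qed
qed

definition shear12 :: "'v \<Rightarrow> 'v"
  where "shear12 = lin_map (e1 + e2) f1 e2 (f2 - f1)"

lemma shear12_Sp [simp]: "shear12 \<in> G"
  unfolding shear12_def by (rule lin_map_in_Sp) simp_all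

lemma shear12_basis [simp]: "shear12 e1 = e1 + e2" "shear12 f1 = f1" "shear12 e2 = e2" "shear12 f2 = f2 - f1"
  by (simp_all add: shear12_def)

lemma swap_shear21: "symplectic_space_4.shear21 scale s e2 f2 e1 f1 = shear12"
  using symplectic_space_4.shear21_Sp[OF swap] symplectic_space_4.shear21_basis[OF swap]
  by (intro Sp_eqI) simp_all

lemma Fix_e2_decomposition:
  assumes "k \<in> Fix e2"
  shows "\<exists>h\<in>L1. \<exists>\<mu>\<in>M. k = h \<circ> \<mu> \<or>
    (\<exists>d\<in>L2. d \<circ> shear12 \<circ> finv d \<in> Fix e2 \<and> k = h \<circ> (d \<circ> shear12 \<circ> finv d) \<circ> \<mu>)"
  using symplectic_space_4.Fix_e1_decomposition[OF swap assms] unfolding swap_shear21 by blast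

lemma generate_Fix_e2: "generate (Sp scale s) (M \<union> L1) = Fix e2"
  using symplectic_space_4.generate_Fix_e1[OF swap] by (metis Int_commute)

text \<open>
  The summand \<open>\<langle>e2, f2\<rangle>\<close> is stable under \<open>L12\<close>. This separates the orbit of \<open>e2\<close> from those of \<open>e2 + e1\<close>
  and \<open>e1\<close>.
\<close>

lemma L12_e2:
  assumes "h \<in> L12"
  shows "s (h e2) f1 = 0"
proof -
  obtain g1 g2 where g: "g1 \<in> L1" "g2 \<in> L2" "h = g1 \<circ> g2"
    using assms by (auto simp: L12_def)
  then have h: "h = g2 \<circ> g1" using L1_commute_L2 by simp
  have "g2 \<in> G" "g2 f1 = f1" "g1 e2 = e2" using g by (auto simp: Fix_iff)
  then show ?thesis using Sp_form[of g2 e2 f1] h by simp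
qed

definition pieces :: "('v \<Rightarrow> 'v) set set"
  where "pieces = {L12, Fix e1, Fix e2, Fix f1, Fix f2}"

lemma pieces_mem [simp]: "L12 \<in> pieces" "Fix e1 \<in> pieces" "Fix e2 \<in> pieces" "Fix f1 \<in> pieces" "Fix f2 \<in> pieces"
  by (auto simp: pieces_def)

lemma pieces_comp: "K \<in> pieces \<Longrightarrow> g \<in> K \<Longrightarrow> h \<in> K \<Longrightarrow> g \<circ> h \<in> K"
  and pieces_inv: "K \<in> pieces \<Longrightarrow> g \<in> K \<Longrightarrow> finv g \<in> K"
  and pieces_Sp: "K \<in> pieces \<Longrightarrow> g \<in> K \<Longrightarrow> g \<in> G"
  by (auto simp: pieces_def L12_comp Fix_comp L12_inv Fix_inv L12_Sp, auto simp: Fix_iff)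

end

section \<open>Double cosets in a group with compatible images of five stabilizers\<close>

text \<open>
  A single map from the union of the five pieces to \<open>U\<close> that is a homomorphism on each piece. A relation between
  isometries is available in \<open>U\<close> only if all of them lie in one common piece.
\<close>

locale piecewise_hom = symplectic_space_4 scale s e1 f1 e2 f2 + U: group U
  for scale :: "'f::field \<Rightarrow> 'v::ab_group_add \<Rightarrow> 'v" and s :: "'v \<Rightarrow> 'v \<Rightarrow> 'f"
    and e1 f1 e2 f2 :: 'v and U :: "'u monoid" (structure) +
  fixes \<iota> :: "('v \<Rightarrow> 'v) \<Rightarrow> 'u"
  assumes closed: "K \<in> pieces \<Longrightarrow> g \<in> K \<Longrightarrow> \<iota> g \<in> carrier U"
    and comp: "K \<in> pieces \<Longrightarrow> g \<in> K \<Longrightarrow> h \<in> K \<Longrightarrow> \<iota> (g \<circ> h) = \<iota> g \<otimes> \<iota> h"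
begin

lemma closed' [simp]:
  "g \<in> L12 \<Longrightarrow> \<iota> g \<in> carrier U" "g \<in> Fix e1 \<Longrightarrow> \<iota> g \<in> carrier U"
  "g \<in> Fix e2 \<Longrightarrow> \<iota> g \<in> carrier U" "g \<in> Fix f1 \<Longrightarrow> \<iota> g \<in> carrier U"
  "g \<in> Fix f2 \<Longrightarrow> \<iota> g \<in> carrier U"
  using closed by (auto simp: pieces_def)

lemma comp':
  "g \<in> L12 \<Longrightarrow> h \<in> L12 \<Longrightarrow> \<iota> (g \<circ> h) = \<iota> g \<otimes> \<iota> h"
  "g \<in> Fix e1 \<Longrightarrow> h \<in> Fix e1 \<Longrightarrow> \<iota> (g \<circ> h) = \<iota> g \<otimes> \<iota> h"
  "g \<in> Fix e2 \<Longrightarrow> h \<in> Fix e2 \<Longrightarrow> \<iota> (g \<circ> h) = \<iota> g \<otimes> \<iota> h"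
  "g \<in> Fix f1 \<Longrightarrow> h \<in> Fix f1 \<Longrightarrow> \<iota> (g \<circ> h) = \<iota> g \<otimes> \<iota> h"
  "g \<in> Fix f2 \<Longrightarrow> h \<in> Fix f2 \<Longrightarrow> \<iota> (g \<circ> h) = \<iota> g \<otimes> \<iota> h"
  using comp by (auto simp: pieces_def)

lemma \<iota>_id: "\<iota> id = \<one>"
proof -
  have "id \<in> Fix e1" by (simp add: Fix_iff)
  then show ?thesis using comp'(2)[of id id] by (metis U.l_cancel_one' closed'(2) comp_id)
qed

lemma \<iota>_inv:
  assumes "K \<in> pieces" "g \<in> K"
  shows "\<iota> (finv g) = inv (\<iota> g)"
proof -
  have "\<iota> (finv g) \<otimes> \<iota> g = \<one>"
    using comp[of K "finv g" g] pieces_inv[OF assms] pieces_Sp[OF assms] assms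
    by (simp add: Sp_inv_comp \<iota>_id)
  then show ?thesis
    using closed[OF assms] closed[OF assms(1) pieces_inv[OF assms]] by (metis U.inv_equality)
qed

text \<open>
  Moving \<open>g\<close> past \<open>h\<close> to the right at the price of a conjugation. In the applications the conjugate has further
  fixed vectors, which place it in a second piece, where the next move is made.
\<close>

lemma slide:
  assumes "K \<in> pieces" "g \<in> K" "h \<in> K"
  shows "finv h \<circ> g \<circ> h \<in> K" "\<iota> g \<otimes> \<iota> h = \<iota> h \<otimes> \<iota> (finv h \<circ> g \<circ> h)"
proof -
  show K: "finv h \<circ> g \<circ> h \<in> K" using assms by (simp add: pieces_comp pieces_inv)
  have "g \<circ> h = h \<circ> (finv h \<circ> g \<circ> h)"
    using pieces_Sp[OF assms(1,3)] by (auto simp: Sp_inv_right)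
  then show "\<iota> g \<otimes> \<iota> h = \<iota> h \<otimes> \<iota> (finv h \<circ> g \<circ> h)"
    using comp[OF assms] comp[OF assms(1,3) K] by simp
qed

lemma slide_inv:
  assumes "K \<in> pieces" "g \<in> K" "h \<in> K"
  shows "h \<circ> g \<circ> finv h \<in> K" "\<iota> g \<otimes> inv (\<iota> h) = inv (\<iota> h) \<otimes> \<iota> (h \<circ> g \<circ> finv h)"
proof -
  show K: "h \<circ> g \<circ> finv h \<in> K" using assms by (simp add: pieces_comp pieces_inv)
  have "g \<circ> finv h = finv h \<circ> (h \<circ> g \<circ> finv h)"
    using pieces_Sp[OF assms(1,3)] by (auto simp: Sp_inv_left)
  then show "\<iota> g \<otimes> inv (\<iota> h) = inv (\<iota> h) \<otimes> \<iota> (h \<circ> g \<circ> finv h)"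
    using comp[OF assms(1,2) pieces_inv[OF assms(1,3)]] comp[OF assms(1) pieces_inv[OF assms(1,3)] K]
    by (simp add: \<iota>_inv[OF assms(1,3)])
qed

lemma shear21_Fix [simp]: "shear21 \<in> Fix e1" "shear21 \<in> Fix f2"
  by (simp_all add: Fix_iff)

lemma shear12_Fix [simp]: "shear12 \<in> Fix e2" "shear12 \<in> Fix f1"
  by (simp_all add: Fix_iff)

text \<open>
  This element lies over \<open>shear12\<^sup>-\<^sup>1 \<circ> shear21\<close>, which carries \<open>e2\<close> to \<open>e2 + e1\<close> and then to \<open>e1\<close>. That
  isometry lies in none of the pieces.
\<close>

definition e2_to_e1 :: 'u
  where "e2_to_e1 = inv (\<iota> shear12) \<otimes> \<iota> shear21"

lemma \<iota>_shear21_closed [simp]: "\<iota> shear21 \<in> carrier U" and \<iota>_shear12_closed [simp]: "\<iota> shear12 \<in> carrier U"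
  and e2_to_e1_closed [simp]: "e2_to_e1 \<in> carrier U"
  using closed'(2)[OF shear21_Fix(1)] closed'(3)[OF shear12_Fix(1)] by (simp_all add: e2_to_e1_def)

lemma \<iota>_shear21_eq: "\<iota> shear21 = \<iota> shear12 \<otimes> e2_to_e1"
  unfolding e2_to_e1_def by (simp add: U.m_assoc[symmetric])

text \<open>
  The shear lies in \<open>Fix e1\<close> with \<open>M\<close>, and it normalizes \<open>M\<close> because it stabilizes the plane
  \<open>\<langle>e1, e2\<rangle>\<close>, which \<open>M\<close> fixes pointwise.
\<close>

lemma M_shear21:
  assumes "\<mu> \<in> M"
  shows "\<exists>\<mu>'\<in>M. \<iota> \<mu> \<otimes> \<iota> shear21 = \<iota> shear21 \<otimes> \<iota> \<mu>'"
proof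
  let ?\<mu>' = "finv shear21 \<circ> \<mu> \<circ> shear21"
  have \<mu>: "\<mu> \<in> G" "\<mu> e1 = e1" "\<mu> e2 = e2" using assms by (auto simp: Fix_iff)
  have "?\<mu>' \<in> Fix e1" and eq: "\<iota> \<mu> \<otimes> \<iota> shear21 = \<iota> shear21 \<otimes> \<iota> ?\<mu>'"
    using slide[of "Fix e1" \<mu> shear21] assms by simp_all
  moreover have "?\<mu>' e2 = e2"
    using \<mu> by (simp add: Sp_linear Sp_inv_eq_iff[OF shear21_Sp, of "e2 + e1"])
  ultimately show "?\<mu>' \<in> M" by (simp add: Fix_iff)
  show "\<iota> \<mu> \<otimes> \<iota> shear21 = \<iota> shear21 \<otimes> \<iota> ?\<mu>'" by (rule eq)
qed

lemma M_e2_to_e1: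
  assumes "\<mu> \<in> M"
  shows "\<exists>\<mu>'\<in>M. \<iota> \<mu> \<otimes> e2_to_e1 = e2_to_e1 \<otimes> \<iota> \<mu>'"
proof -
  let ?\<mu>1 = "shear12 \<circ> \<mu> \<circ> finv shear12"
  have \<mu>: "\<mu> \<in> G" "\<mu> e1 = e1" "\<mu> e2 = e2" using assms by (auto simp: Fix_iff)
  have 1: "?\<mu>1 \<in> Fix e2" and eq: "\<iota> \<mu> \<otimes> inv (\<iota> shear12) = inv (\<iota> shear12) \<otimes> \<iota> ?\<mu>1"
    using slide_inv[of "Fix e2" \<mu> shear12] assms by simp_all
  moreover have "finv shear12 e1 = e1 - e2" by (simp add: Sp_inv_eq_iff Sp_linear)
  then have "?\<mu>1 e1 = e1" using \<mu> by (simp add: Sp_linear)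
  ultimately have "?\<mu>1 \<in> M" by (simp add: Fix_iff)
  from M_shear21[OF this] obtain \<mu>' where \<mu>': "\<mu>' \<in> M" "\<iota> ?\<mu>1 \<otimes> \<iota> shear21 = \<iota> shear21 \<otimes> \<iota> \<mu>'" by blast
  have "\<iota> \<mu> \<otimes> e2_to_e1 = \<iota> \<mu> \<otimes> inv (\<iota> shear12) \<otimes> \<iota> shear21"
    using assms by (simp add: e2_to_e1_def U.m_assoc)
  also have "\<dots> = inv (\<iota> shear12) \<otimes> (\<iota> ?\<mu>1 \<otimes> \<iota> shear21)"
    using 1 by (simp add: eq U.m_assoc)
  also have "\<dots> = e2_to_e1 \<otimes> \<iota> \<mu>'"
    using \<mu>' by (simp add: e2_to_e1_def U.m_assoc)
  finally show ?thesis using \<mu>'(1) by blast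
qed

text \<open>
  The isometry \<open>z\<close> fixes the plane \<open>\<langle>f1, f2\<rangle>\<close> pointwise, and both shears stabilize this plane. So the
  conjugate of \<open>z\<close> by \<open>shear12\<close>, formed in \<open>Fix f1\<close>, again lies in \<open>Fix f2\<close>, where it can be conjugated by \<open>shear21\<close>.
  The result fixes \<open>e2\<close> because \<open>z\<close> fixes \<open>e1\<close>, the image of \<open>e2\<close> under \<open>e2_to_e1\<close>.
\<close>

lemma L2_e2_to_e1_lower:
  assumes z: "z \<in> L2" "z f2 = f2"
  shows "\<exists>k\<in>Fix e2. \<iota> z \<otimes> e2_to_e1 = e2_to_e1 \<otimes> \<iota> k"
proof
  have zG: "z \<in> G" "z e1 = e1" "z f1 = f1" using z by (auto simp: Fix_iff)
  let ?k1 = "shear12 \<circ> z \<circ> finv shear12"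
  let ?k2 = "finv shear21 \<circ> ?k1 \<circ> shear21"
  have 1: "?k1 \<in> Fix f1" and eq1: "\<iota> z \<otimes> inv (\<iota> shear12) = inv (\<iota> shear12) \<otimes> \<iota> ?k1"
    using slide_inv[of "Fix f1" z shear12] z by simp_all
  have "finv shear12 f2 = f2 + f1" by (simp add: Sp_inv_eq_iff Sp_linear)
  then have "?k1 f2 = f2" using zG z by (simp add: Sp_linear)
  then have "?k1 \<in> Fix f2" using 1 by (simp add: Fix_iff)
  then have 2: "?k2 \<in> Fix f2" and eq2: "\<iota> ?k1 \<otimes> \<iota> shear21 = \<iota> shear21 \<otimes> \<iota> ?k2"
    using slide[of "Fix f2" ?k1 shear21] by simp_all
  have "finv shear12 (e2 + e1) = e1" "finv shear21 (e1 + e2) = e2" by (simp_all add: Sp_inv_eq_iff add.commute)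
  then have "?k2 e2 = e2" using zG by simp
  then show k2: "?k2 \<in> Fix e2" using 2 by (simp add: Fix_iff)
  have "\<iota> z \<otimes> e2_to_e1 = \<iota> z \<otimes> inv (\<iota> shear12) \<otimes> \<iota> shear21"
    using z by (simp add: e2_to_e1_def U.m_assoc)
  also have "\<dots> = inv (\<iota> shear12) \<otimes> (\<iota> ?k1 \<otimes> \<iota> shear21)"
    using 1 by (simp add: eq1 U.m_assoc)
  also have "\<dots> = e2_to_e1 \<otimes> \<iota> ?k2"
    using k2 by (simp add: eq2 e2_to_e1_def U.m_assoc)
  finally show "\<iota> z \<otimes> e2_to_e1 = e2_to_e1 \<otimes> \<iota> ?k2" .
qed

text \<open>
  In terms of cosets: the coset of \<open>e2_to_e1\<close>, which stands for the vector \<open>e1\<close>, is fixed by \<open>L2\<close> just as \<open>e1\<close>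
  is. The group \<open>L2\<close> is a copy of \<open>SL\<^sub>2\<close> and hence generated by the elements that fix \<open>e2\<close> and those that fix \<open>f2\<close>;
  the former lie in \<open>M\<close>.
\<close>

lemma L2_e2_to_e1:
  assumes g: "g \<in> L2"
  shows "\<exists>k\<in>Fix e2. \<iota> g \<otimes> e2_to_e1 = e2_to_e1 \<otimes> \<iota> k"
proof -
  define N where "N = {g \<in> L2. \<exists>k\<in>Fix e2. \<iota> g \<otimes> e2_to_e1 = e2_to_e1 \<otimes> \<iota> k}"
  have comp_N: "g \<circ> h \<in> N" if gh: "g \<in> N" "h \<in> N" for g h
  proof -
    obtain k l where k: "g \<in> L2" "k \<in> Fix e2" "\<iota> g \<otimes> e2_to_e1 = e2_to_e1 \<otimes> \<iota> k"
      and l: "h \<in> L2" "l \<in> Fix e2" "\<iota> h \<otimes> e2_to_e1 = e2_to_e1 \<otimes> \<iota> l"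
      using gh unfolding N_def by blast
    have "\<iota> (g \<circ> h) \<otimes> e2_to_e1 = \<iota> g \<otimes> (\<iota> h \<otimes> e2_to_e1)"
      using k l by (simp add: comp'(2) U.m_assoc)
    also have "\<dots> = \<iota> g \<otimes> e2_to_e1 \<otimes> \<iota> l"
      unfolding l(3) using k(1) l(2) by (simp add: U.m_assoc)
    also have "\<dots> = e2_to_e1 \<otimes> \<iota> (k \<circ> l)"
      unfolding k(3) using k(2) l(2) by (simp add: comp'(3) U.m_assoc)
    finally show ?thesis using k l Fix_comp by (auto simp: N_def)
  qed
  have upper: "g \<in> N" if "g \<in> L2" "g e2 = e2" for g
  proof -
    have "g \<in> M" using that by (simp add: Fix_iff)
    then show ?thesis using M_e2_to_e1[of g] that by (auto simp: N_def)
  qed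
  have lower: "g \<in> N" if "g \<in> L2" "g f2 = f2" for g
    using L2_e2_to_e1_lower[OF that] that by (auto simp: N_def)
  \<comment> \<open>The case where \<open>g\<close> does not stabilize the line of \<open>e2\<close>: \<open>g\<close> is upper times lower times upper unitriangular.\<close>
  have cell: "g \<in> N" if g: "g \<in> L2" and b: "g e2 = scale a e2 + scale b f2" "b \<noteq> 0" for g a b
  proof -
    obtain u where u: "u \<in> L2" "u e2 = e2" "u f2 = scale ((a - 1) / b) e2 + f2"
      using symplectic_space_4.ex_L1[OF swap, of 1 1 0 "(a - 1) / b"] by auto
    obtain z where z: "z \<in> L2" "z e2 = e2 + scale b f2" "z f2 = f2"
      using symplectic_space_4.ex_L1[OF swap, of 1 1 b 0] by auto
    have uz: "u \<in> G" "z \<in> G" using u z by (auto simp: Fix_iff)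
    let ?w = "finv z \<circ> finv u \<circ> g"
    have w: "?w \<in> L2" using u z g by (simp_all add: Fix_comp Fix_inv)
    have "u (z e2) = e2 + scale (b * ((a - 1) / b)) e2 + scale b f2"
      using u z uz by (simp add: Sp_add Sp_scale scale_right_distrib add.assoc)
    also have "b * ((a - 1) / b) = a - 1" using b(2) by simp
    also have "e2 + scale (a - 1) e2 = scale a e2" by (simp add: scale_left_diff_distrib)
    finally have "u (z e2) = scale a e2 + scale b f2" .
    then have "g e2 = u (z e2)" using b by simp
    then have w2: "?w e2 = e2" using uz by (simp add: Sp_inv_left)
    have "u \<circ> (z \<circ> ?w) \<in> N" by (intro comp_N upper lower u z w w2)
    also have "u \<circ> (z \<circ> ?w) = g" using uz by (auto simp: Sp_inv_right)
    finally show ?thesis .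
  qed
  have gG: "g \<in> G" "g e1 = e1" "g f1 = f1" using g by (auto simp: Fix_iff)
  obtain a b where ab: "g e2 = scale a e2 + scale b f2"
  proof
    have "s (g e2) f1 = 0" "s e1 (g e2) = 0"
      using Sp_form[OF gG(1), of e2 f1] Sp_form[OF gG(1), of e1 e2] gG by simp_all
    then show "g e2 = scale (s (g e2) f2) e2 + scale (s e2 (g e2)) f2"
      using basis_expansion[of "g e2"] by simp
  qed
  have "g \<in> N"
  proof (cases "b = 0")
    case False
    then show ?thesis using cell g ab by blast
  next
    case True
    have "a \<noteq> 0"
    proof
      assume "a = 0"
      then have "g e2 = g 0" using ab True gG by (simp add: Sp_linear)
      then have "e2 = 0" using Sp_inj gG by blast
      then have "s e2 f2 = 0" by (metis form_zero(1))
      then show False by simp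
    qed
    obtain z where z: "z \<in> L2" "z e2 = e2 + f2" "z f2 = f2"
      using symplectic_space_4.ex_L1[OF swap, of 1 1 1 0] by auto
    have zG: "z \<in> G" using z by (auto simp: Fix_iff)
    have "z \<circ> g \<in> L2" using z g by (simp add: Fix_comp)
    moreover have "(z \<circ> g) e2 = scale a e2 + scale a f2"
      using ab True z zG by (simp add: Sp_linear scale_right_distrib)
    ultimately have "z \<circ> g \<in> N" using cell \<open>a \<noteq> 0\<close> by blast
    moreover have "finv z \<in> N"
      by (rule lower) (use z zG Fix_inv in \<open>auto simp: Sp_inv_eq_iff\<close>)
    ultimately have "finv z \<circ> (z \<circ> g) \<in> N" by (rule comp_N[rotated])
    also have "finv z \<circ> (z \<circ> g) = g" using zG by (auto simp: Sp_inv_left)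
    finally show ?thesis .
  qed
  then show ?thesis by (simp add: N_def)
qed

text \<open>
  The double cosets of the representatives for the three orbits of \<open>L12\<close> on the nonzero vectors: vectors in
  \<open>\<langle>e2, f2\<rangle>\<close>, vectors with two nonzero components, and vectors in \<open>\<langle>e1, f1\<rangle>\<close>.
\<close>

definition cosets :: "'u set"
  where "cosets = {\<iota> g \<otimes> r \<otimes> \<iota> q | g r q. g \<in> L12 \<and> r \<in> {\<one>, \<iota> shear21, e2_to_e1} \<and> q \<in> Fix e2}"

lemma cosets_I: "g \<in> L12 \<Longrightarrow> r \<in> {\<one>, \<iota> shear21, e2_to_e1} \<Longrightarrow> q \<in> Fix e2 \<Longrightarrow> \<iota> g \<otimes> r \<otimes> \<iota> q \<in> cosets"
  by (auto simp: cosets_def)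

lemma cosets_closed: "p \<in> cosets \<Longrightarrow> p \<in> carrier U"
  by (auto simp: cosets_def)

lemma cosets_right:
  assumes "p \<in> cosets" "k \<in> Fix e2"
  shows "p \<otimes> \<iota> k \<in> cosets"
proof -
  obtain g r q where *: "g \<in> L12" "r \<in> {\<one>, \<iota> shear21, e2_to_e1}" "q \<in> Fix e2" "p = \<iota> g \<otimes> r \<otimes> \<iota> q"
    using assms(1) by (auto simp: cosets_def)
  have "p \<otimes> \<iota> k = \<iota> g \<otimes> r \<otimes> \<iota> (q \<circ> k)"
    using * assms(2) by (auto simp: U.m_assoc comp'(3))
  then show ?thesis using * assms(2) by (auto intro!: cosets_I Fix_comp)
qed

lemma cosets_left:
  assumes "p \<in> cosets" "k \<in> L12"
  shows "\<iota> k \<otimes> p \<in> cosets"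
proof -
  obtain g r q where *: "g \<in> L12" "r \<in> {\<one>, \<iota> shear21, e2_to_e1}" "q \<in> Fix e2" "p = \<iota> g \<otimes> r \<otimes> \<iota> q"
    using assms(1) by (auto simp: cosets_def)
  have "\<iota> k \<otimes> p = \<iota> (k \<circ> g) \<otimes> r \<otimes> \<iota> q"
    using * assms(2) by (auto simp: U.m_assoc comp'(1))
  then show ?thesis using * assms(2) by (auto intro!: cosets_I L12_comp)
qed

lemma id_L12 [simp]: "id \<in> L12" and id_Fix [simp]: "id \<in> Fix v"
  using L1_sub_L12[of id] by (simp_all add: Fix_iff)

lemma cosets_one: "\<one> \<in> cosets" and cosets_e2_to_e1: "e2_to_e1 \<in> cosets"
  using cosets_I[of id \<one> id] cosets_I[of id "\<iota> shear21" id] cosets_I[of id e2_to_e1 id] by (simp_all add: \<iota>_id)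

text \<open>
  The rescaled shear in the decomposition of \<open>k\<close> is expanded inside \<open>Fix f2\<close>; the torus element \<open>d\<^sup>-\<^sup>1\<close> on its
  right lies in \<open>L1\<close> and is absorbed by \<open>Fix e2\<close>.
\<close>

lemma Fix_e1_cosets:
  assumes "k \<in> Fix e1"
  shows "\<iota> k \<in> cosets"
proof -
  obtain h \<mu> where h: "h \<in> L2" and \<mu>: "\<mu> \<in> M" and or: "k = h \<circ> \<mu> \<or>
      (\<exists>d\<in>L1. d \<circ> shear21 \<circ> finv d \<in> Fix e1 \<and> k = h \<circ> (d \<circ> shear21 \<circ> finv d) \<circ> \<mu>)"
    using Fix_e1_decomposition[OF assms] by blast
  have hS: "h \<in> L12" by (rule L2_sub_L12[OF h])
  from or show ?thesis
  proof
    assume "k = h \<circ> \<mu>"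
    then have "\<iota> k = \<iota> h \<otimes> (\<one> \<otimes> \<iota> \<mu>)" using h \<mu> by (simp add: comp'(2))
    then show ?thesis using cosets_left[OF cosets_right[OF cosets_one]] \<mu> hS by auto
  next
    assume "\<exists>d\<in>L1. d \<circ> shear21 \<circ> finv d \<in> Fix e1 \<and> k = h \<circ> (d \<circ> shear21 \<circ> finv d) \<circ> \<mu>"
    then obtain d where d: "d \<in> L1" "d \<circ> shear21 \<circ> finv d \<in> Fix e1"
      and k: "k = h \<circ> (d \<circ> shear21 \<circ> finv d) \<circ> \<mu>" by blast
    have di: "finv d \<in> Fix e2" "finv d \<in> Fix f2" using d by (simp_all add: Fix_inv)
    have "\<iota> k = \<iota> h \<otimes> \<iota> (d \<circ> shear21 \<circ> finv d) \<otimes> \<iota> \<mu>"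
      unfolding k using h \<mu> d by (simp add: comp'(2) Fix_comp)
    also have "\<iota> (d \<circ> shear21 \<circ> finv d) = \<iota> d \<otimes> \<iota> shear21 \<otimes> \<iota> (finv d)"
      using d di by (simp add: comp'(5) Fix_comp)
    finally have "\<iota> k = \<iota> h \<otimes> (\<iota> d \<otimes> \<iota> shear21 \<otimes> \<iota> (finv d)) \<otimes> \<iota> \<mu>" .
    moreover have "\<iota> d \<otimes> \<iota> shear21 \<otimes> \<iota> (finv d) \<in> cosets"
      using cosets_I[of d "\<iota> shear21" "finv d"] d di L1_sub_L12 by simp
    ultimately show ?thesis using cosets_right[OF cosets_left] \<mu> hS by auto
  qed
qed

text \<open>
  Mirror image of the previous argument, with the expansion inside \<open>Fix f1\<close>. Now the torus element \<open>d\<^sup>-\<^sup>1\<close> lies in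
  \<open>L2\<close> and is moved through \<open>e2_to_e1\<close>, and \<open>shear12\<close> times \<open>e2_to_e1\<close> is the shear representing the middle orbit.
\<close>

lemma Fix_e2_e2_to_e1_cosets:
  assumes "k \<in> Fix e2"
  shows "\<iota> k \<otimes> e2_to_e1 \<in> cosets"
proof -
  obtain h \<mu> where h: "h \<in> L1" and \<mu>: "\<mu> \<in> M" and or: "k = h \<circ> \<mu> \<or>
      (\<exists>d\<in>L2. d \<circ> shear12 \<circ> finv d \<in> Fix e2 \<and> k = h \<circ> (d \<circ> shear12 \<circ> finv d) \<circ> \<mu>)"
    using Fix_e2_decomposition[OF assms] by blast
  obtain \<mu>' where \<mu>': "\<mu>' \<in> M" "\<iota> \<mu> \<otimes> e2_to_e1 = e2_to_e1 \<otimes> \<iota> \<mu>'" using M_e2_to_e1[OF \<mu>] by blast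
  have hS: "h \<in> L12" by (rule L1_sub_L12[OF h])
  from or show ?thesis
  proof
    assume "k = h \<circ> \<mu>"
    then have "\<iota> k \<otimes> e2_to_e1 = \<iota> h \<otimes> (e2_to_e1 \<otimes> \<iota> \<mu>')"
      using h \<mu> \<mu>' by (simp add: comp'(3) U.m_assoc)
    then show ?thesis using cosets_left[OF cosets_right[OF cosets_e2_to_e1]] \<mu>' hS by auto
  next
    assume "\<exists>d\<in>L2. d \<circ> shear12 \<circ> finv d \<in> Fix e2 \<and> k = h \<circ> (d \<circ> shear12 \<circ> finv d) \<circ> \<mu>"
    then obtain d where d: "d \<in> L2" "d \<circ> shear12 \<circ> finv d \<in> Fix e2"
      and k: "k = h \<circ> (d \<circ> shear12 \<circ> finv d) \<circ> \<mu>" by blast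
    have di: "finv d \<in> L2" using d by (simp_all add: Fix_inv)
    obtain q where q: "q \<in> Fix e2" "\<iota> (finv d) \<otimes> e2_to_e1 = e2_to_e1 \<otimes> \<iota> q"
      using L2_e2_to_e1[OF di] by blast
    have "\<iota> k \<otimes> e2_to_e1 = \<iota> h \<otimes> \<iota> (d \<circ> shear12 \<circ> finv d) \<otimes> (\<iota> \<mu> \<otimes> e2_to_e1)"
      unfolding k using h \<mu> d by (simp add: comp'(3) Fix_comp U.m_assoc)
    also have "\<iota> (d \<circ> shear12 \<circ> finv d) = \<iota> d \<otimes> \<iota> shear12 \<otimes> \<iota> (finv d)"
      using d di by (simp add: comp'(4) Fix_comp)
    also have "\<iota> h \<otimes> (\<iota> d \<otimes> \<iota> shear12 \<otimes> \<iota> (finv d)) \<otimes> (\<iota> \<mu> \<otimes> e2_to_e1) =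
        \<iota> h \<otimes> (\<iota> d \<otimes> \<iota> shear12 \<otimes> (\<iota> (finv d) \<otimes> e2_to_e1)) \<otimes> \<iota> \<mu>'"
      using h d di \<mu>' by (simp add: U.m_assoc)
    also have "\<dots> = \<iota> h \<otimes> (\<iota> d \<otimes> \<iota> shear21 \<otimes> \<iota> q) \<otimes> \<iota> \<mu>'"
      using d q by (simp add: \<iota>_shear21_eq U.m_assoc)
    finally have "\<iota> k \<otimes> e2_to_e1 = \<iota> h \<otimes> (\<iota> d \<otimes> \<iota> shear21 \<otimes> \<iota> q) \<otimes> \<iota> \<mu>'" .
    moreover have "\<iota> d \<otimes> \<iota> shear21 \<otimes> \<iota> q \<in> cosets"
      using cosets_I[of d "\<iota> shear21" q] d q L2_sub_L12 by simp
    ultimately show ?thesis using cosets_right[OF cosets_left] \<mu>' hS by auto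
  qed
qed

text \<open>
  Let \<open>x\<close> be the image of \<open>e2 + e1\<close> under \<open>h1 \<circ> h2\<close>; both of its \<open>f\<close>-coordinates are nonzero. Therefore the displacement of
  \<open>x\<close> by \<open>\<mu>\<close>, a vector of \<open>\<langle>e1, e2\<rangle>\<close>, is also achieved by some \<open>v \<in> L12 \<inter> M\<close>, and \<open>\<mu>' = v\<^sup>-\<^sup>1 \<mu>\<close> fixes \<open>x\<close>. It is
  here that \<open>h1\<close> and \<open>h2\<close> are chosen to carry \<open>\<langle>f1, f2\<rangle>\<close> to \<open>\<langle>e1, e2\<rangle>\<close>: as \<open>\<mu>'\<close> fixes the latter plane, its
  successive conjugates gain the fixed vectors \<open>f1\<close> and \<open>f2\<close>, which allows \<open>\<mu>'\<close> to be moved past \<open>h1\<close> in \<open>Fix e2\<close>,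
  past \<open>h2\<close> in \<open>Fix f1\<close> and past the shear in \<open>Fix f2\<close>. The last conjugate fixes \<open>e2\<close> because \<open>\<mu>'\<close> fixes \<open>x\<close>.
\<close>

lemma M_L12_shear21_generic:
  assumes \<mu>: "\<mu> \<in> M"
    and h1: "h1 \<in> L1" "h1 e1 = scale a1 e1 + scale b1 f1" "h1 f1 = scale (- inverse b1) e1"
    and h2: "h2 \<in> L2" "h2 e2 = scale a2 e2 + scale b2 f2" "h2 f2 = scale (- inverse b2) e2"
    and b: "b1 \<noteq> 0" "b2 \<noteq> 0"
  shows "\<iota> \<mu> \<otimes> (\<iota> h1 \<otimes> \<iota> h2 \<otimes> \<iota> shear21) \<in> cosets"
proof -
  have \<mu>G: "\<mu> \<in> G" "\<mu> e1 = e1" "\<mu> e2 = e2" using \<mu> by (auto simp: Fix_iff)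
  have hG: "h1 \<in> G" "h2 \<in> G" "h1 e2 = e2" "h2 e1 = e1" "h2 f1 = f1" using h1 h2 by (auto simp: Fix_iff)
  define x where "x = h1 (h2 (e2 + e1))"
  have x: "x = scale a1 e1 + scale b1 f1 + (scale a2 e2 + scale b2 f2)"
  proof -
    have "h1 f2 = f2" using h1 by (auto simp: Fix_iff)
    then show ?thesis using hG h1 h2 by (simp add: x_def Sp_linear)
  qed
  define t1 where "t1 = (s (\<mu> x) f1 - a1) / b1"
  define t2 where "t2 = (s (\<mu> x) f2 - a2) / b2"
  have "s (\<mu> x) e1 = s x e1" "s (\<mu> x) e2 = s x e2"
    using Sp_form[OF \<mu>G(1), of x e1] Sp_form[OF \<mu>G(1), of x e2] \<mu>G by simp_all
  then have "s e1 (\<mu> x) = b1" "s e2 (\<mu> x) = b2"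
    unfolding form_skew[of e1 "\<mu> x"] form_skew[of e2 "\<mu> x"] by (simp_all add: x)
  then have \<mu>x: "\<mu> x = scale (a1 + b1 * t1) e1 + scale b1 f1 + scale (a2 + b2 * t2) e2 + scale b2 f2"
    using basis_expansion[of "\<mu> x"] b by (simp add: t1_def t2_def)
  obtain v1 where v1: "v1 \<in> L1" "v1 e1 = e1" "v1 f1 = scale t1 e1 + f1"
    using ex_L1[of 1 1 0 t1] by auto
  obtain v2 where v2: "v2 \<in> L2" "v2 e2 = e2" "v2 f2 = scale t2 e2 + f2"
    using symplectic_space_4.ex_L1[OF swap, of 1 1 0 t2] by auto
  let ?v = "v1 \<circ> v2"
  have vG: "v1 \<in> G" "v2 \<in> G" using v1 v2 by (auto simp: Fix_iff)
  have vM: "?v \<in> M" using v1 v2 by (simp add: Fix_iff Sp_comp_closed)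
  have vS: "?v \<in> L12" using v1 v2 by (intro L12_I)
  have vx: "?v x = \<mu> x"
  proof -
    have "v1 f2 = f2" "v1 e2 = e2" "v2 e1 = e1" "v2 f1 = f1"
      using v1 v2 by (auto simp: Fix_iff)
    then have "?v x = scale (a1 + b1 * t1) e1 + scale b1 f1 + scale (a2 + b2 * t2) e2 + scale b2 f2"
      unfolding x using v1 v2 vG by (simp add: Sp_linear algebra_simps)
    then show ?thesis by (simp only: \<mu>x)
  qed
  define \<mu>' where "\<mu>' = finv ?v \<circ> \<mu>"
  have \<mu>'M: "\<mu>' \<in> M" unfolding \<mu>'_def using vM \<mu> Fix_comp Fix_inv by (metis IntE IntI)
  have vvG: "?v \<in> G" using vM by (simp add: Fix_iff)
  have \<mu>'x: "\<mu>' x = x" unfolding \<mu>'_def comp_apply[of "finv ?v"] vx[symmetric] by (rule Sp_inv_left[OF vvG])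
  have \<mu>_eq: "\<mu> = ?v \<circ> \<mu>'" unfolding \<mu>'_def using Sp_inv_right[OF vvG] by (metis (no_types, lifting) comp_apply ext)
  have \<mu>'G: "\<mu>' \<in> G" "\<mu>' e1 = e1" "\<mu>' e2 = e2" using \<mu>'M by (auto simp: Fix_iff)
  let ?\<mu>1 = "finv h1 \<circ> \<mu>' \<circ> h1"
  have 1: "?\<mu>1 \<in> Fix e2" and eq1: "\<iota> \<mu>' \<otimes> \<iota> h1 = \<iota> h1 \<otimes> \<iota> ?\<mu>1"
    using slide[of "Fix e2" \<mu>' h1] \<mu>'M h1 by simp_all
  have "?\<mu>1 f1 = f1"
    using Sp_inv_eq_iff[OF hG(1)] h1(3) \<mu>'G by (simp add: Sp_linear)
  then have mu1_f1: "?\<mu>1 \<in> Fix f1" using 1 by (simp add: Fix_iff)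
  let ?\<mu>2 = "finv h2 \<circ> ?\<mu>1 \<circ> h2"
  have 2: "?\<mu>2 \<in> Fix f1" and eq2: "\<iota> ?\<mu>1 \<otimes> \<iota> h2 = \<iota> h2 \<otimes> \<iota> ?\<mu>2"
    using slide[of "Fix f1" ?\<mu>1 h2] mu1_f1 h2 by simp_all
  have "?\<mu>2 f2 = finv h2 (?\<mu>1 (h2 f2))" by simp
  also have "?\<mu>1 (h2 f2) = h2 f2"
    using 1 by (simp only: h2(3) Fix_iff Sp_scale[of ?\<mu>1])
  finally have "?\<mu>2 f2 = f2" using hG by (simp add: Sp_inv_left del: comp_apply)
  then have mu2_f2: "?\<mu>2 \<in> Fix f2" using 2 by (simp add: Fix_iff)
  let ?\<mu>3 = "finv shear21 \<circ> ?\<mu>2 \<circ> shear21"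
  have 3: "?\<mu>3 \<in> Fix f2" and eq3: "\<iota> ?\<mu>2 \<otimes> \<iota> shear21 = \<iota> shear21 \<otimes> \<iota> ?\<mu>3"
    using slide[of "Fix f2" ?\<mu>2 shear21] mu2_f2 by simp_all
  have "?\<mu>3 e2 = finv shear21 (finv h2 (finv h1 (\<mu>' x)))" by (simp add: x_def)
  also have "finv h2 (finv h1 (\<mu>' x)) = e2 + e1"
    unfolding \<mu>'x unfolding x_def using hG by (simp only: Sp_inv_left)
  also have "finv shear21 (e2 + e1) = e2" by (simp add: Sp_inv_eq_iff)
  finally have mu3_e2: "?\<mu>3 \<in> Fix e2" using 3 by (simp add: Fix_iff)
  have "\<iota> \<mu> \<otimes> (\<iota> h1 \<otimes> \<iota> h2 \<otimes> \<iota> shear21) = \<iota> ?v \<otimes> ((\<iota> \<mu>' \<otimes> \<iota> h1) \<otimes> \<iota> h2 \<otimes> \<iota> shear21)"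
    using vM \<mu>'M h1 h2 by (subst \<mu>_eq) (simp add: comp'(2) U.m_assoc)
  also have "\<dots> = \<iota> ?v \<otimes> (\<iota> h1 \<otimes> (\<iota> ?\<mu>1 \<otimes> \<iota> h2) \<otimes> \<iota> shear21)"
    using vM 1 h1 h2 by (simp add: eq1 U.m_assoc)
  also have "\<dots> = \<iota> ?v \<otimes> (\<iota> h1 \<otimes> \<iota> h2 \<otimes> (\<iota> ?\<mu>2 \<otimes> \<iota> shear21))"
    using vM 2 h1 h2 by (simp add: eq2 U.m_assoc)
  also have "\<dots> = \<iota> ?v \<otimes> (\<iota> (h1 \<circ> h2) \<otimes> \<iota> shear21 \<otimes> \<iota> ?\<mu>3)"
    using vM 3 h1 h2 L1_sub_L12 L2_sub_L12 by (simp add: eq3 U.m_assoc comp'(1))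
  also have "\<dots> \<in> cosets"
    by (intro cosets_left cosets_I) (use vS mu3_e2 h1 h2 L12_I in auto)
  finally show ?thesis .
qed

text \<open>
  Write \<open>g = g1 \<circ> g2\<close> with \<open>g1 \<in> L1\<close> and \<open>g2 \<in> L2\<close>. If \<open>g2\<close> stabilizes the line of \<open>e2\<close>, it normalizes \<open>M\<close>, and the
  rest takes place in \<open>Fix e2\<close> after the shear is written as \<open>shear12\<close> times \<open>e2_to_e1\<close>. If \<open>g1\<close> stabilizes the line of
  \<open>e1\<close>, everything takes place in \<open>Fix e1\<close>. Otherwise \<open>g\<close> may be changed on the right by elements of \<open>L12 \<inter> M\<close>, which
  pass through the shear, so as to reach the generic case.
\<close>

lemma M_L12_shear21:
  assumes \<mu>: "\<mu> \<in> M" and g: "g \<in> L12"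
  shows "\<iota> \<mu> \<otimes> (\<iota> g \<otimes> \<iota> shear21) \<in> cosets"
proof -
  obtain g1 g2 where g12: "g1 \<in> L1" "g2 \<in> L2" "g = g1 \<circ> g2"
    using g by (auto simp: L12_def)
  have S: "g1 \<in> L12" "g2 \<in> L12" using g12 L1_sub_L12 L2_sub_L12 by auto
  have \<mu>G: "\<mu> \<in> G" "\<mu> e1 = e1" "\<mu> e2 = e2" using \<mu> by (auto simp: Fix_iff)
  have G1: "g1 \<in> G" "g1 e2 = e2" "g1 f2 = f2" and G2: "g2 \<in> G" "g2 e1 = e1" "g2 f1 = f1"
    using g12 by (auto simp: Fix_iff)
  define a1 where "a1 = s (g1 e1) f1"
  define b1 where "b1 = s e1 (g1 e1)"
  define a2 where "a2 = s (g2 e2) f2"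
  define b2 where "b2 = s e2 (g2 e2)"
  have "s (g1 e1) f2 = 0" "s e2 (g1 e1) = 0"
    using Sp_form[OF G1(1), of e1 f2] Sp_form[OF G1(1), of e2 e1] G1 by simp_all
  then have g1: "g1 e1 = scale a1 e1 + scale b1 f1"
    using basis_expansion[of "g1 e1"] by (simp add: a1_def b1_def)
  have "s (g2 e2) f1 = 0" "s e1 (g2 e2) = 0"
    using Sp_form[OF G2(1), of e2 f1] Sp_form[OF G2(1), of e1 e2] G2 by simp_all
  then have g2: "g2 e2 = scale a2 e2 + scale b2 f2"
    using basis_expansion[of "g2 e2"] by (simp add: a2_def b2_def)
  consider "b2 = 0" | "b1 = 0" | "b1 \<noteq> 0" "b2 \<noteq> 0" by blast
  then show ?thesis
  proof cases
    assume "b2 = 0"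
    let ?\<mu>' = "finv g2 \<circ> \<mu> \<circ> g2"
    have 1: "?\<mu>' \<in> Fix e1" and eq: "\<iota> \<mu> \<otimes> \<iota> g2 = \<iota> g2 \<otimes> \<iota> ?\<mu>'"
      using slide[of "Fix e1" \<mu> g2] \<mu> g12 by simp_all
    have "\<mu> (g2 e2) = g2 e2" using g2 \<open>b2 = 0\<close> \<mu>G by (simp add: Sp_linear)
    then have "?\<mu>' \<in> Fix e2" using 1 G2 by (simp add: Fix_iff Sp_inv_left)
    then have 2: "?\<mu>' \<circ> g1 \<circ> shear12 \<in> Fix e2"
      and eq2: "\<iota> (?\<mu>' \<circ> g1 \<circ> shear12) = \<iota> ?\<mu>' \<otimes> \<iota> g1 \<otimes> \<iota> shear12"
      using g12 by (simp_all add: Fix_comp comp'(3))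
    have "g = g2 \<circ> g1" using g12 L1_commute_L2 by simp
    then have "\<iota> \<mu> \<otimes> (\<iota> g \<otimes> \<iota> shear21) = (\<iota> \<mu> \<otimes> \<iota> g2) \<otimes> (\<iota> g1 \<otimes> \<iota> shear21)"
      using S \<mu> by (simp add: comp'(1) U.m_assoc)
    also have "\<dots> = \<iota> g2 \<otimes> (\<iota> (?\<mu>' \<circ> g1 \<circ> shear12) \<otimes> e2_to_e1)"
      unfolding eq eq2 using S 1 by (simp add: \<iota>_shear21_eq U.m_assoc)
    also have "\<dots> \<in> cosets" using S 2 Fix_e2_e2_to_e1_cosets cosets_left by blast
    finally show ?thesis .
  next
    assume "b1 = 0"
    let ?\<mu>' = "finv g1 \<circ> \<mu> \<circ> g1"
    have 1: "?\<mu>' \<in> Fix e2" and eq: "\<iota> \<mu> \<otimes> \<iota> g1 = \<iota> g1 \<otimes> \<iota> ?\<mu>'"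
      using slide[of "Fix e2" \<mu> g1] \<mu> g12 by simp_all
    have "\<mu> (g1 e1) = g1 e1" using g1 \<open>b1 = 0\<close> \<mu>G by (simp add: Sp_linear)
    then have "?\<mu>' \<in> Fix e1" using 1 G1 by (simp add: Fix_iff Sp_inv_left)
    then have 2: "?\<mu>' \<circ> g2 \<circ> shear21 \<in> Fix e1"
      and eq2: "\<iota> (?\<mu>' \<circ> g2 \<circ> shear21) = \<iota> ?\<mu>' \<otimes> \<iota> g2 \<otimes> \<iota> shear21"
      using g12 by (simp_all add: Fix_comp comp'(2))
    have "\<iota> \<mu> \<otimes> (\<iota> g \<otimes> \<iota> shear21) = (\<iota> \<mu> \<otimes> \<iota> g1) \<otimes> (\<iota> g2 \<otimes> \<iota> shear21)"
      using S \<mu> g12(3) by (simp add: comp'(1) U.m_assoc)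
    also have "\<dots> = \<iota> g1 \<otimes> \<iota> (?\<mu>' \<circ> g2 \<circ> shear21)"
      unfolding eq eq2 using S 1 by (simp add: U.m_assoc)
    also have "\<dots> \<in> cosets" using S 2 Fix_e1_cosets cosets_left by blast
    finally show ?thesis .
  next
    assume b: "b1 \<noteq> 0" "b2 \<noteq> 0"
    \<comment> \<open>Only the first columns of \<open>g1\<close> and \<open>g2\<close> matter: changing the second columns multiplies
      \<open>g\<close> on the right by an element of \<open>L12 \<inter> M\<close>.\<close>
    obtain h1 where h1: "h1 \<in> L1" "h1 e1 = scale a1 e1 + scale b1 f1" "h1 f1 = scale (- inverse b1) e1"
      using ex_L1[of a1 0 b1 "- inverse b1"] b by auto
    obtain h2 where h2: "h2 \<in> L2" "h2 e2 = scale a2 e2 + scale b2 f2" "h2 f2 = scale (- inverse b2) e2"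
      using symplectic_space_4.ex_L1[OF swap, of a2 0 b2 "- inverse b2"] b by auto
    let ?u1 = "finv h1 \<circ> g1" and ?u2 = "finv h2 \<circ> g2"
    have hG: "h1 \<in> G" "h2 \<in> G" using h1 h2 by (auto simp: Fix_iff)
    have uS: "?u1 \<in> L1" "?u2 \<in> L2" using h1 h2 g12 by (simp_all add: Fix_comp Fix_inv)
    have "?u1 e1 = e1" using g1 h1(2)[symmetric] hG by (simp add: Sp_inv_left)
    moreover have "?u2 e2 = e2" using g2 h2(2)[symmetric] hG by (simp add: Sp_inv_left)
    ultimately have uM: "?u1 \<in> M" "?u2 \<in> M" using uS by (simp_all add: Fix_iff)
    have g1u: "g1 = h1 \<circ> ?u1" and g2u: "g2 = h2 \<circ> ?u2" using hG by (auto simp: Sp_inv_right)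
    have "g = (h1 \<circ> ?u1) \<circ> (h2 \<circ> ?u2)"
      by (simp only: g12(3) g1u[symmetric] g2u[symmetric])
    also have "\<dots> = h1 \<circ> (?u1 \<circ> h2) \<circ> ?u2" by (simp only: comp_assoc)
    also have "?u1 \<circ> h2 = h2 \<circ> ?u1" using L1_commute_L2 uS h2 by blast
    finally have g': "g = h1 \<circ> h2 \<circ> (?u1 \<circ> ?u2)" by (simp only: comp_assoc)
    have u: "?u1 \<circ> ?u2 \<in> M" "?u1 \<circ> ?u2 \<in> L12" using uM uS by (simp_all add: Fix_comp L12_I)
    obtain \<mu>' where \<mu>': "\<mu>' \<in> M" "\<iota> (?u1 \<circ> ?u2) \<otimes> \<iota> shear21 = \<iota> shear21 \<otimes> \<iota> \<mu>'"
      using M_shear21[OF u(1)] by blast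
    have hS: "h1 \<in> L12" "h2 \<in> L12" "h1 \<circ> h2 \<in> L12"
      using h1 h2 L1_sub_L12 L2_sub_L12 L12_I by auto
    have "\<iota> g = \<iota> h1 \<otimes> \<iota> h2 \<otimes> \<iota> (?u1 \<circ> ?u2)"
      by (subst g') (use hS u in \<open>simp add: comp'(1)\<close>)
    then have "\<iota> \<mu> \<otimes> (\<iota> g \<otimes> \<iota> shear21) = \<iota> \<mu> \<otimes> (\<iota> h1 \<otimes> \<iota> h2 \<otimes> (\<iota> (?u1 \<circ> ?u2) \<otimes> \<iota> shear21))"
      using \<mu> hS u by (simp add: U.m_assoc)
    also have "\<dots> = \<iota> \<mu> \<otimes> (\<iota> h1 \<otimes> \<iota> h2 \<otimes> \<iota> shear21) \<otimes> \<iota> \<mu>'"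
      unfolding \<mu>'(2) using \<mu> hS \<mu>'(1) by (simp add: U.m_assoc)
    also have "\<dots> \<in> cosets"
      using M_L12_shear21_generic[OF \<mu> h1 h2 b] \<mu>'(1) cosets_right by blast
    finally show ?thesis .
  qed
qed

lemma M_cosets:
  assumes \<mu>: "\<mu> \<in> M" and p: "p \<in> cosets"
  shows "\<iota> \<mu> \<otimes> p \<in> cosets"
proof -
  obtain g r q where g: "g \<in> L12" and r: "r \<in> {\<one>, \<iota> shear21, e2_to_e1}" and q: "q \<in> Fix e2"
    and p: "p = \<iota> g \<otimes> r \<otimes> \<iota> q"
    using p by (auto simp: cosets_def)
  have "\<iota> \<mu> \<otimes> (\<iota> g \<otimes> r) \<in> cosets"
  proof -
    obtain g1 g2 where g12: "g1 \<in> L1" "g2 \<in> L2" "g = g1 \<circ> g2"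
      using g by (auto simp: L12_def)
    have S: "g1 \<in> L12" "g2 \<in> L12" using g12 L1_sub_L12 L2_sub_L12 by auto
    consider "r = \<one>" | "r = \<iota> shear21" | "r = e2_to_e1" using r by blast
    then show ?thesis
    proof cases
      case 1
      have "g = g2 \<circ> g1" using g12 L1_commute_L2 by simp
      then have "\<iota> \<mu> \<otimes> (\<iota> g \<otimes> r) = \<iota> (\<mu> \<circ> g2) \<otimes> \<iota> g1"
        using S \<mu> g12 1 by (simp add: comp'(1,2) U.m_assoc)
      moreover have "\<iota> (\<mu> \<circ> g2) \<in> cosets" using \<mu> g12 by (simp add: Fix_comp Fix_e1_cosets)
      ultimately show ?thesis using cosets_right g12 by auto
    next
      case 2
      then show ?thesis using M_L12_shear21[OF \<mu> g] by simp
    next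
      case 3
      obtain k where k: "k \<in> Fix e2" "\<iota> g2 \<otimes> e2_to_e1 = e2_to_e1 \<otimes> \<iota> k" using L2_e2_to_e1 g12 by blast
      have "\<iota> \<mu> \<otimes> (\<iota> g \<otimes> r) = \<iota> (\<mu> \<circ> g1) \<otimes> (\<iota> g2 \<otimes> e2_to_e1)"
        using S \<mu> g12 3 by (simp add: comp'(1,3) U.m_assoc)
      also have "\<dots> = \<iota> (\<mu> \<circ> g1) \<otimes> e2_to_e1 \<otimes> \<iota> k"
        unfolding k(2) using k(1) \<mu> g12 by (simp add: U.m_assoc Fix_comp)
      also have "\<dots> \<in> cosets"
        using \<mu> g12 k(1) by (intro cosets_right Fix_e2_e2_to_e1_cosets Fix_comp) auto
      finally show ?thesis .
    qed
  qed
  then have "\<iota> \<mu> \<otimes> (\<iota> g \<otimes> r) \<otimes> \<iota> q \<in> cosets" using q by (rule cosets_right)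
  moreover have "r \<in> carrier U" using r by auto
  ultimately show ?thesis using \<mu> g q p by (simp add: U.m_assoc)
qed

text \<open>
  Left multiplication by \<open>M\<close> and \<open>L12\<close> preserves the double cosets, so the same holds for the groups that \<open>M\<close>
  generates with \<open>L1\<close> or \<open>L2\<close> inside one piece.
\<close>

lemma cosets_mult_subgroup:
  assumes "A \<in> {L1, L2}" "K \<in> pieces" "g \<in> generate (Sp scale s) (M \<union> A)" "M \<union> A \<subseteq> K"
    "subgroup K (Sp scale s)"
  shows "p \<in> cosets \<Longrightarrow> \<iota> g \<otimes> p \<in> cosets"
proof -
  have gen: "\<iota> g \<otimes> p \<in> cosets" if "g \<in> M \<union> A" "p \<in> cosets" for g p
    using that assms(1) M_cosets cosets_left L1_sub_L12 L2_sub_L12 by blast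
  have incl: "g \<in> K" if "g \<in> generate (Sp scale s) (M \<union> A)" for g
    using group.generate_subgroup_incl[OF group_Sp assms(4,5)] that by blast
  show "\<iota> g \<otimes> p \<in> cosets" if "p \<in> cosets"
    using assms(3) that
  proof (induction arbitrary: p rule: generate.induct)
    case one
    then show ?case using cosets_closed by (simp only: one_Sp \<iota>_id U.l_one)
  next
    case (incl h)
    then show ?case using gen by blast
  next
    case (inv h)
    have "h \<in> G" using inv assms(1) by (auto simp: Fix_iff)
    moreover have "finv h \<in> M \<union> A" using inv assms(1) by (auto intro: Fix_inv)
    ultimately show ?case using gen inv by (simp add: m_inv_Sp)
  next
    case (eng h1 h2)
    have "h1 \<in> K" "h2 \<in> K" using eng.hyps incl by auto
    then have "\<iota> (h1 \<circ> h2) \<otimes> p = \<iota> h1 \<otimes> (\<iota> h2 \<otimes> p)"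
      using comp[OF assms(2)] closed[OF assms(2)] cosets_closed[OF eng.prems] by (simp add: U.m_assoc)
    also have "\<dots> \<in> cosets" by (intro eng.IH eng.prems)
    finally show ?case by (simp only: mult_Sp)
  qed
qed

lemma mult_cosets:
  assumes "g \<in> L12 \<union> Fix e1 \<union> Fix e2" "p \<in> cosets"
  shows "\<iota> g \<otimes> p \<in> cosets"
proof -
  consider "g \<in> L12" | "g \<in> Fix e1" | "g \<in> Fix e2" using assms(1) by blast
  then show ?thesis
  proof cases
    case 1
    then show ?thesis using cosets_left assms(2) by blast
  next
    case 2
    then show ?thesis
      using cosets_mult_subgroup[of L2 "Fix e1" g p] assms(2) subgroup_Fix by (auto simp: generate_Fix_e1)
  next
    case 3
    then show ?thesis
      using cosets_mult_subgroup[of L1 "Fix e2" g p] assms(2) subgroup_Fix by (auto simp: generate_Fix_e2)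
  qed
qed

text \<open>
  The representative of the double coset of \<open>p\<close> carries \<open>e2\<close> into the \<open>L12\<close>-orbit of \<open>\<pi> p e2 = e2\<close>, so it is \<open>1\<close>.
  Then \<open>p\<close> lies in the image of \<open>Fix e2\<close>, on which \<open>\<pi>\<close> is injective.
\<close>

lemma cosets_kernel:
  assumes hom: "\<pi> \<in> hom U (Sp scale s)"
    and sec: "\<And>K g. K \<in> pieces \<Longrightarrow> g \<in> K \<Longrightarrow> \<pi> (\<iota> g) = g"
    and p: "p \<in> cosets" "\<pi> p = id"
  shows "p = \<one>"
proof -
  interpret S: group "Sp scale s" by (rule group_Sp)
  interpret \<pi>: group_hom U "Sp scale s" \<pi> by unfold_locales (rule hom)
  obtain g r q where g: "g \<in> L12" and r: "r \<in> {\<one>, \<iota> shear21, e2_to_e1}" and q: "q \<in> Fix e2"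
    and peq: "p = \<iota> g \<otimes> r \<otimes> \<iota> q"
    using p(1) by (auto simp: cosets_def)
  have rU: "r \<in> carrier U" using r by auto
  have "\<pi> p = g \<circ> \<pi> r \<circ> q"
    unfolding peq using g q rU sec[of L12 g] sec[of "Fix e2" q] by simp
  then have "(g \<circ> \<pi> r \<circ> q) e2 = e2" by (simp only: p(2) id_apply)
  moreover have "q e2 = e2" using q by (simp add: Fix_iff)
  ultimately have g_r: "g (\<pi> r e2) = e2" by simp
  then have "\<pi> r e2 = finv g e2" using L12_Sp[OF g] Sp_inv_left by metis
  then have "s (\<pi> r e2) f1 = 0" using L12_e2[OF L12_inv[OF g]] by simp
  moreover have "\<pi> (\<iota> shear21) e2 = e2 + e1" using sec[of "Fix e1" shear21] by simp
  moreover have "\<pi> e2_to_e1 e2 = e1"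
  proof -
    have "\<pi> (inv (\<iota> shear12)) = finv shear12"
      using sec[of "Fix e2" "finv shear12"] \<iota>_inv[of "Fix e2" shear12] Fix_inv[OF shear12_Fix(1)] by simp
    then have "\<pi> e2_to_e1 = finv shear12 \<circ> shear21" using sec[of "Fix e1" shear21] by (simp add: e2_to_e1_def)
    then show ?thesis by (simp add: Sp_inv_eq_iff add.commute)
  qed
  ultimately have "r = \<one>" using r by auto
  then have "g e2 = e2" using g_r by simp
  then have gF: "g \<in> Fix e2" using L12_Sp[OF g] by (simp add: Fix_iff)
  then have "p = \<iota> (g \<circ> q)" using peq \<open>r = \<one>\<close> q by (simp add: comp'(3))
  moreover from this have "g \<circ> q = id" using sec[of "Fix e2" "g \<circ> q"] gF q Fix_comp p(2) by simp
  ultimately show ?thesis by (simp only: \<iota>_id)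
qed

end

section \<open>Extending the amalgam to the stabilizers of all basis vectors\<close>

text \<open>
  A cocone over the amalgam, reduced to its maps \<open>a\<close> on \<open>S\<^sub>1\<^sub>2\<close>, \<open>b\<close> on \<open>Q\<^sub>1\<^sub>1\<close> and \<open>c\<close> on \<open>Q\<^sub>1\<^sub>2\<close>. They agree on
  the smaller members, where the arrows of the amalgam make them agree.
\<close>

locale amalgam_cocone = symplectic_space_4 scale s e1 f1 e2 f2 + U: group U
  for scale :: "'f::field \<Rightarrow> 'v::ab_group_add \<Rightarrow> 'v" and s :: "'v \<Rightarrow> 'v \<Rightarrow> 'f"
    and e1 f1 e2 f2 :: 'v and U :: "'u monoid" (structure) +
  fixes a b c :: "('v \<Rightarrow> 'v) \<Rightarrow> 'u"
  assumes a_closed: "g \<in> L12 \<Longrightarrow> a g \<in> carrier U"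
    and a_comp: "g \<in> L12 \<Longrightarrow> h \<in> L12 \<Longrightarrow> a (g \<circ> h) = a g \<otimes> a h"
    and b_closed: "g \<in> Fix e2 \<Longrightarrow> b g \<in> carrier U"
    and b_comp: "g \<in> Fix e2 \<Longrightarrow> h \<in> Fix e2 \<Longrightarrow> b (g \<circ> h) = b g \<otimes> b h"
    and c_closed: "g \<in> Fix e1 \<Longrightarrow> c g \<in> carrier U"
    and c_comp: "g \<in> Fix e1 \<Longrightarrow> h \<in> Fix e1 \<Longrightarrow> c (g \<circ> h) = c g \<otimes> c h"
    and a_b: "g \<in> L1 \<Longrightarrow> a g = b g"
    and a_c: "g \<in> L2 \<Longrightarrow> a g = c g"
    and b_c: "g \<in> M \<Longrightarrow> b g = c g"
begin

text \<open>
  The Weyl elements of \<open>L1\<close> and \<open>L2\<close>: they exchange \<open>e1\<close> with \<open>f1\<close>, respectively \<open>e2\<close> with \<open>f2\<close>, up to sign.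
\<close>

definition n1 :: "'v \<Rightarrow> 'v" where "n1 = lin_map f1 (- e1) e2 f2"
definition n2 :: "'v \<Rightarrow> 'v" where "n2 = lin_map e1 f1 f2 (- e2)"

lemma n1_Sp [simp]: "n1 \<in> G" and n2_Sp [simp]: "n2 \<in> G"
  unfolding n1_def n2_def by (rule lin_map_in_Sp; simp)+

lemma n_basis [simp]:
  "n1 e1 = f1" "n1 f1 = - e1" "n1 e2 = e2" "n1 f2 = f2"
  "n2 e1 = e1" "n2 f1 = f1" "n2 e2 = f2" "n2 f2 = - e2"
  by (simp_all add: n1_def n2_def)

lemma n_Fix [simp]: "n1 \<in> Fix e2" "n1 \<in> Fix f2" "n2 \<in> Fix e1" "n2 \<in> Fix f1"
  by (simp_all add: Fix_iff)

lemma n_L12 [simp]: "n1 \<in> L12" "n2 \<in> L12"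
  by (simp_all add: L1_sub_L12 L2_sub_L12)

text \<open>
  The \<open>L2\<close>-part of an element of \<open>L12 \<inter> Fix e2\<close> lies in \<open>M\<close>, so \<open>a\<close> and \<open>b\<close> are compared through \<open>c\<close> there.
\<close>

lemma a_b_L12:
  assumes "g \<in> L12" "g \<in> Fix e2"
  shows "a g = b g"
proof -
  obtain g1 g2 where g: "g1 \<in> L1" "g2 \<in> L2" "g = g1 \<circ> g2"
    using assms(1) by (auto simp: L12_def)
  have gG: "g1 \<in> G" "g2 \<in> G" "g1 e2 = e2" using g by (auto simp: Fix_iff)
  have "g1 (g2 e2) = g1 e2" using assms(2) g gG by (simp add: Fix_iff)
  then have "g2 e2 = e2" using Sp_inj gG by blast
  then have g2M: "g2 \<in> M" using g by (simp add: Fix_iff)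
  have "a g = a g1 \<otimes> a g2" using g a_comp L1_sub_L12 L2_sub_L12 by simp
  also have "\<dots> = b g1 \<otimes> b g2" using g g2M a_b a_c b_c by simp
  also have "\<dots> = b g" using g g2M b_comp by simp
  finally show ?thesis .
qed

lemma a_c_L12:
  assumes "g \<in> L12" "g \<in> Fix e1"
  shows "a g = c g"
proof -
  obtain g1 g2 where g: "g1 \<in> L1" "g2 \<in> L2" "g = g1 \<circ> g2"
    using assms(1) by (auto simp: L12_def)
  have g': "g = g2 \<circ> g1" using g L1_commute_L2 by simp
  have gG: "g1 \<in> G" "g2 \<in> G" "g2 e1 = e1" using g by (auto simp: Fix_iff)
  have "g2 (g1 e1) = g2 e1" using assms(2) g' gG by (simp add: Fix_iff)
  then have "g1 e1 = e1" using Sp_inj gG by blast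
  then have g1M: "g1 \<in> M" using g by (simp add: Fix_iff)
  have "a g = a g1 \<otimes> a g2" using g a_comp L1_sub_L12 L2_sub_L12 by simp
  also have "\<dots> = c g1 \<otimes> c g2" using g g1M a_b a_c b_c[OF g1M] by simp
  also have "\<dots> = c g" using g g1M c_comp by simp
  finally show ?thesis .
qed

text \<open>
  Conjugation by \<open>n2\<close> carries \<open>Fix f2\<close> to \<open>Fix e2\<close>, which transports \<open>b\<close> to \<open>Fix f2\<close>; likewise \<open>c\<close> to \<open>Fix f1\<close>.
\<close>

definition b_f2 :: "('v \<Rightarrow> 'v) \<Rightarrow> 'u"
  where "b_f2 g = a n2 \<otimes> b (finv n2 \<circ> g \<circ> n2) \<otimes> inv (a n2)"

definition c_f1 :: "('v \<Rightarrow> 'v) \<Rightarrow> 'u"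
  where "c_f1 g = a n1 \<otimes> c (finv n1 \<circ> g \<circ> n1) \<otimes> inv (a n1)"

lemma conj_n2:
  assumes "g \<in> Fix f2"
  shows "finv n2 \<circ> g \<circ> n2 \<in> Fix e2"
  using assms by (simp add: Fix_iff Sp_comp_closed Sp_inv_closed Sp_inv_eq_iff)

lemma conj_n1:
  assumes "g \<in> Fix f1"
  shows "finv n1 \<circ> g \<circ> n1 \<in> Fix e1"
  using assms by (simp add: Fix_iff Sp_comp_closed Sp_inv_closed Sp_inv_eq_iff)

lemma conj_comp:
  assumes "n \<in> G"
  shows "finv n \<circ> (g \<circ> h) \<circ> n = (finv n \<circ> g \<circ> n) \<circ> (finv n \<circ> h \<circ> n)"
  using Sp_inv_right[OF assms] by auto

text \<open>
  If \<open>n\<close> itself lies in the domain, transporting by \<open>n\<close> changes nothing. This is the reason for all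
  agreements below: each intersection of pieces lies in a piece that contains the Weyl element used.
\<close>

lemma conj_hom:
  assumes K: "K \<in> pieces" "g \<in> K" "n \<in> K"
    and closed: "\<And>h. h \<in> K \<Longrightarrow> \<phi> h \<in> carrier U"
    and comp: "\<And>h k. h \<in> K \<Longrightarrow> k \<in> K \<Longrightarrow> \<phi> (h \<circ> k) = \<phi> h \<otimes> \<phi> k"
  shows "\<phi> n \<otimes> \<phi> (finv n \<circ> g \<circ> n) \<otimes> inv (\<phi> n) = \<phi> g"
proof -
  have k: "finv n \<circ> g \<circ> n \<in> K" using K pieces_comp pieces_inv by simp
  have "n \<circ> (finv n \<circ> g \<circ> n) = g \<circ> n"
    using Sp_inv_right[OF pieces_Sp[OF K(1,3)]] by auto
  then have "\<phi> n \<otimes> \<phi> (finv n \<circ> g \<circ> n) = \<phi> g \<otimes> \<phi> n"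
    using comp[OF K(3) k] comp[OF K(2,3)] by simp
  then show ?thesis using closed[OF K(2)] closed[OF K(3)] by (simp add: U.m_assoc)
qed

lemma b_f2_closed: "g \<in> Fix f2 \<Longrightarrow> b_f2 g \<in> carrier U"
  and c_f1_closed: "g \<in> Fix f1 \<Longrightarrow> c_f1 g \<in> carrier U"
  by (simp_all add: b_f2_def c_f1_def a_closed b_closed c_closed conj_n1 conj_n2)

lemma inv_cancel_middle:
  assumes "x \<in> carrier U" "y \<in> carrier U" "z \<in> carrier U"
  shows "x \<otimes> (y \<otimes> z) \<otimes> inv x = (x \<otimes> y \<otimes> inv x) \<otimes> (x \<otimes> z \<otimes> inv x)"
proof -
  have "inv x \<otimes> (x \<otimes> (z \<otimes> inv x)) = z \<otimes> inv x"
    using assms by (simp add: U.m_assoc[symmetric])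
  then show ?thesis using assms by (simp add: U.m_assoc)
qed

lemma b_f2_comp: "g \<in> Fix f2 \<Longrightarrow> h \<in> Fix f2 \<Longrightarrow> b_f2 (g \<circ> h) = b_f2 g \<otimes> b_f2 h"
  unfolding b_f2_def conj_comp[OF n2_Sp]
  by (subst b_comp) (auto intro!: conj_n2 inv_cancel_middle a_closed b_closed)

lemma c_f1_comp: "g \<in> Fix f1 \<Longrightarrow> h \<in> Fix f1 \<Longrightarrow> c_f1 (g \<circ> h) = c_f1 g \<otimes> c_f1 h"
  unfolding c_f1_def conj_comp[OF n1_Sp]
  by (subst c_comp) (auto intro!: conj_n1 inv_cancel_middle a_closed c_closed)

lemma b_f2_a:
  assumes "g \<in> Fix f2" "g \<in> L12"
  shows "b_f2 g = a g"
proof -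
  have "b (finv n2 \<circ> g \<circ> n2) = a (finv n2 \<circ> g \<circ> n2)"
    using a_b_L12[OF _ conj_n2[OF assms(1)]] assms(2) by (simp add: L12_comp L12_inv)
  then show ?thesis
    unfolding b_f2_def using conj_hom[of L12 g n2 a] assms a_closed a_comp by simp
qed

lemma c_f1_a:
  assumes "g \<in> Fix f1" "g \<in> L12"
  shows "c_f1 g = a g"
proof -
  have "c (finv n1 \<circ> g \<circ> n1) = a (finv n1 \<circ> g \<circ> n1)"
    using a_c_L12[OF _ conj_n1[OF assms(1)]] assms(2) by (simp add: L12_comp L12_inv)
  then show ?thesis
    unfolding c_f1_def using conj_hom[of L12 g n1 a] assms a_closed a_comp by simp
qed

lemma b_f2_c:
  assumes "g \<in> Fix f2" "g \<in> Fix e1"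
  shows "b_f2 g = c g"
proof -
  have "finv n2 \<circ> g \<circ> n2 \<in> Fix e1" using assms by (intro Fix_comp Fix_inv) auto
  then have "b (finv n2 \<circ> g \<circ> n2) = c (finv n2 \<circ> g \<circ> n2)"
    using b_c conj_n2[OF assms(1)] by blast
  moreover have "a n2 = c n2" using a_c by simp
  ultimately show ?thesis
    unfolding b_f2_def using conj_hom[of "Fix e1" g n2 c] assms c_closed c_comp by simp
qed

lemma c_f1_b:
  assumes "g \<in> Fix f1" "g \<in> Fix e2"
  shows "c_f1 g = b g"
proof -
  have "finv n1 \<circ> g \<circ> n1 \<in> Fix e2" using assms by (intro Fix_comp Fix_inv) auto
  then have "c (finv n1 \<circ> g \<circ> n1) = b (finv n1 \<circ> g \<circ> n1)"
    using b_c conj_n1[OF assms(1)] by auto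
  moreover have "a n1 = b n1" using a_b by simp
  ultimately show ?thesis
    unfolding c_f1_def using conj_hom[of "Fix e2" g n1 b] assms b_closed b_comp by simp
qed

lemma c_f1_b_f2:
  assumes "g \<in> Fix f1" "g \<in> Fix f2"
  shows "c_f1 g = b_f2 g"
proof -
  have "finv n1 \<circ> g \<circ> n1 \<in> Fix f2" using assms by (intro Fix_comp Fix_inv) auto
  then have "c (finv n1 \<circ> g \<circ> n1) = b_f2 (finv n1 \<circ> g \<circ> n1)"
    using b_f2_c conj_n1[OF assms(1)] by auto
  moreover have "a n1 = b_f2 n1" using b_f2_a[of n1] by simp
  ultimately show ?thesis
    unfolding c_f1_def using conj_hom[of "Fix f2" g n1 b_f2] assms b_f2_closed b_f2_comp by simp
qed

text \<open>
  The order of the cases is immaterial, since the maps agree wherever two of their domains meet.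
\<close>

definition \<iota> :: "('v \<Rightarrow> 'v) \<Rightarrow> 'u"
  where "\<iota> g = (if g \<in> L12 then a g else if g \<in> Fix e1 then c g else if g \<in> Fix e2 then b g
    else if g \<in> Fix f2 then b_f2 g else c_f1 g)"

lemma \<iota>_eq:
  "g \<in> L12 \<Longrightarrow> \<iota> g = a g" "g \<in> Fix e1 \<Longrightarrow> \<iota> g = c g" "g \<in> Fix e2 \<Longrightarrow> \<iota> g = b g"
  "g \<in> Fix f2 \<Longrightarrow> \<iota> g = b_f2 g" "g \<in> Fix f1 \<Longrightarrow> \<iota> g = c_f1 g"
proof -
  have S: "g \<in> L12" if "g \<in> Fix e1 \<and> g \<in> Fix f1 \<or> g \<in> Fix e2 \<and> g \<in> Fix f2" for g
    using that L1_sub_L12 L2_sub_L12 by blast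
  show "g \<in> L12 \<Longrightarrow> \<iota> g = a g" by (simp add: \<iota>_def)
  show "g \<in> Fix e1 \<Longrightarrow> \<iota> g = c g" by (simp add: \<iota>_def a_c_L12)
  show "g \<in> Fix e2 \<Longrightarrow> \<iota> g = b g" using b_c[of g] by (simp add: \<iota>_def a_b_L12)
  show "g \<in> Fix f2 \<Longrightarrow> \<iota> g = b_f2 g" using S[of g] by (simp add: \<iota>_def b_f2_a b_f2_c)
  show "g \<in> Fix f1 \<Longrightarrow> \<iota> g = c_f1 g" using S[of g] by (simp add: \<iota>_def c_f1_a c_f1_b c_f1_b_f2)
qed

sublocale piecewise_hom scale s e1 f1 e2 f2 U \<iota>
proof
  fix K g assume K: "K \<in> pieces" and g: "g \<in> K"
  then show "\<iota> g \<in> carrier U"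
    by (auto simp: pieces_def \<iota>_eq a_closed b_closed c_closed b_f2_closed c_f1_closed)
  fix h assume h: "h \<in> K"
  show "\<iota> (g \<circ> h) = \<iota> g \<otimes> \<iota> h"
    using K g h
    by (auto simp: pieces_def \<iota>_eq L12_comp Fix_comp a_comp b_comp c_comp b_f2_comp c_f1_comp)
qed

lemma kernel_trivial:
  assumes hom: "\<pi> \<in> hom U (Sp scale s)"
    and \<pi>: "\<And>g. g \<in> L12 \<Longrightarrow> \<pi> (a g) = g" "\<And>g. g \<in> Fix e2 \<Longrightarrow> \<pi> (b g) = g"
      "\<And>g. g \<in> Fix e1 \<Longrightarrow> \<pi> (c g) = g"
    and p: "p \<in> cosets" "\<pi> p = id"
  shows "p = \<one>"
proof (rule cosets_kernel[OF hom _ p])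
  interpret S: group "Sp scale s" by (rule group_Sp)
  interpret \<pi>: group_hom U "Sp scale s" \<pi> by unfold_locales (rule hom)
  have conj: "n \<circ> (finv n \<circ> g \<circ> n) \<circ> finv n = g" if "n \<in> G" for n g
    using that by (auto simp: Sp_inv_right)
  fix K g assume "K \<in> pieces" "g \<in> K"
  then consider "g \<in> L12" | "g \<in> Fix e1" | "g \<in> Fix e2" | "g \<in> Fix f1" | "g \<in> Fix f2"
    by (auto simp: pieces_def)
  then show "\<pi> (\<iota> g) = g"
  proof cases
    case 4
    then show ?thesis
      using conj_n1[OF 4] conj[OF n1_Sp, of g]
      by (simp add: \<iota>_eq c_f1_def a_closed c_closed \<pi> m_inv_Sp)
  next
    case 5
    then show ?thesis
      using conj_n2[OF 5] conj[OF n2_Sp, of g]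
      by (simp add: \<iota>_eq b_f2_def a_closed b_closed \<pi> m_inv_Sp)
  qed (simp_all add: \<iota>_eq \<pi>)
qed

lemma mult_cosets':
  "g \<in> L12 \<Longrightarrow> p \<in> cosets \<Longrightarrow> a g \<otimes> p \<in> cosets" "g \<in> Fix e2 \<Longrightarrow> p \<in> cosets \<Longrightarrow> b g \<otimes> p \<in> cosets"
  "g \<in> Fix e1 \<Longrightarrow> p \<in> cosets \<Longrightarrow> c g \<otimes> p \<in> cosets"
  using mult_cosets[of g p] by (simp_all add: \<iota>_eq)

end

section \<open>Symplectic blocks and the structure of the members\<close>

lemma vector_space_scale2: "vector_space scale2"
  by unfold_locales (auto simp: scale2_def algebra_simps)

lemma mult_Sp2 [simp]: "g \<otimes>\<^bsub>Sp2\<^esub> h = g \<circ> h"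
  by (simp add: Sp2_def)

text \<open>
  Bijectivity is automatic: Cramer's rule in the basis \<open>h (1, 0)\<close>, \<open>h (0, 1)\<close> gives preimages.
\<close>

lemma carrier_Sp2:
  "h \<in> carrier Sp2 \<longleftrightarrow> (\<forall>v w. h (v + w) = h v + h w) \<and> (\<forall>x v. h (scale2 x v) = scale2 x (h v)) \<and>
    (\<forall>v w. form2 (h v) (h w) = form2 v w)" (is "?L \<longleftrightarrow> ?R")
proof
  show "?L \<Longrightarrow> ?R" by (simp add: Sp2_def carrier_Sp Vector_Spaces.linear_iff)
  assume R: ?R
  have "inj h"
  proof (rule injI)
    fix x y assume "h x = h y"
    then have "form2 x z = form2 y z" for z using R by metis
    from this[of "(0, 1)"] this[of "(1, 0)"] show "x = y"
      by (simp add: form2_def prod_eq_iff)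
  qed
  moreover have "surj h"
  proof (rule surjI)
    fix z
    define u where "u = h (1, 0)"
    define w where "w = h (0, 1)"
    have uw: "fst u * snd w - snd u * fst w = 1"
      using R unfolding u_def w_def by (metis (no_types, lifting) form2_def fst_conv snd_conv mult_1 mult_zero_left diff_zero)
    have "(form2 z w, form2 u z) = scale2 (form2 z w) (1, 0) + scale2 (form2 u z) (0, 1)"
      by (simp add: scale2_def)
    then have "h (form2 z w, form2 u z) = h (scale2 (form2 z w) (1, 0) + scale2 (form2 u z) (0, 1))"
      by (rule arg_cong)
    also have "\<dots> = scale2 (form2 z w) u + scale2 (form2 u z) w"
      unfolding u_def w_def using R by metis
    also have "\<dots> = scale2 (fst u * snd w - snd u * fst w) z"
      by (simp add: scale2_def form2_def prod_eq_iff algebra_simps)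
    also have "\<dots> = z" by (simp add: uw scale2_def)
    finally show "h (form2 z w, form2 u z) = z" .
  qed
  ultimately show ?L using R vector_space_scale2
    by (simp add: Sp2_def carrier_Sp Vector_Spaces.linear_iff bij_def)
qed

lemma Sp2_eqI:
  assumes "g \<in> carrier Sp2" "h \<in> carrier Sp2" "g (1, 0) = h (1, 0)" "g (0, 1) = h (0, 1)"
  shows "g = h"
proof
  fix v :: "'a \<times> 'a"
  have v: "v = scale2 (fst v) (1, 0) + scale2 (snd v) (0, 1)"
    by (simp add: scale2_def)
  show "g v = h v"
    by (subst (1 2) v) (use assms in \<open>simp only: carrier_Sp2\<close>)
qed

lemma form2_basis: "h \<in> carrier Sp2 \<Longrightarrow> form2 (h (1, 0)) (h (0, 1)) = 1"
  by (simp add: carrier_Sp2) (simp add: form2_def)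

context symplectic_space_4
begin

text \<open>
  The plane \<open>\<langle>e2, f2\<rangle>\<close> in coordinates, the projection onto it, and the block of \<open>g\<close> there.
\<close>

definition emb2 :: "'f \<times> 'f \<Rightarrow> 'v"
  where "emb2 w = scale (fst w) e2 + scale (snd w) f2"

definition co2 :: "'v \<Rightarrow> 'f \<times> 'f"
  where "co2 v = (s v f2, s e2 v)"

definition block2 :: "('v \<Rightarrow> 'v) \<Rightarrow> 'f \<times> 'f \<Rightarrow> 'f \<times> 'f"
  where "block2 g w = co2 (g (emb2 w))"

lemma emb2_basis [simp]: "emb2 (1, 0) = e2" "emb2 (0, 1) = f2"
  by (simp_all add: emb2_def)

lemma co2_emb2 [simp]: "co2 (emb2 w) = w"
  by (simp add: co2_def emb2_def)

lemma co2_linear: "co2 (v + w) = co2 v + co2 w" "co2 (scale x v) = scale2 x (co2 v)"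
  by (simp_all add: co2_def scale2_def)

lemma emb2_linear: "emb2 (v + w) = emb2 v + emb2 w" "emb2 (scale2 x v) = scale x (emb2 v)"
  by (simp_all add: emb2_def scale2_def algebra_simps)

lemma form_emb2 [simp]: "s (emb2 v) (emb2 w) = form2 v w"
    "s e1 (emb2 v) = 0" "s (emb2 v) e1 = 0" "s f1 (emb2 v) = 0" "s (emb2 v) f1 = 0"
  by (simp_all add: emb2_def form2_def)

lemma co2_pair [simp]: "co2 e1 = 0" "co2 f1 = 0"
  by (simp_all add: co2_def zero_prod_def)

lemma expansion2: "v = scale (s v f1) e1 + scale (s e1 v) f1 + emb2 (co2 v)"
  using basis_expansion[of v] by (simp add: emb2_def co2_def add.assoc)

lemma form_expansion2: "s v w = s v f1 * s e1 w - s e1 v * s w f1 + form2 (co2 v) (co2 w)"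
  using form_expansion[of v w] by (simp add: co2_def form2_def)

text \<open>
  A common home for \<open>Fix e1\<close> and \<open>L12\<close>. For these isometries \<open>g\<close> maps \<open>\<langle>e2, f2\<rangle>\<close> into \<open>\<langle>e1, e2, f2\<rangle>\<close>
  and the projection of \<open>g e1\<close> vanishes, which is what makes \<open>block2\<close> multiplicative and symplectic.
\<close>

definition block_triangular :: "('v \<Rightarrow> 'v) set"
  where "block_triangular = {g \<in> G. (\<forall>w. s e1 (g (emb2 w)) = 0) \<and> co2 (g e1) = 0}"

lemma block2_Sp2:
  assumes "g \<in> block_triangular"
  shows "block2 g \<in> carrier Sp2"
proof -
  have g: "g \<in> G" "\<And>w. s e1 (g (emb2 w)) = 0" using assms by (auto simp: block_triangular_def)
  have "form2 (block2 g v) (block2 g w) = form2 v w" for v w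
    using Sp_form[OF g(1), of "emb2 v" "emb2 w"] form_expansion2[of "g (emb2 v)" "g (emb2 w)"]
    by (simp add: g block2_def)
  then show ?thesis
    using g by (simp add: carrier_Sp2 block2_def emb2_linear Sp_linear co2_linear)
qed

lemma block2_comp:
  assumes g: "g \<in> block_triangular" and h: "h \<in> block_triangular"
  shows "block2 (g \<circ> h) = block2 g \<circ> block2 h"
proof
  fix w
  let ?v = "h (emb2 w)"
  have gG: "g \<in> G" "co2 (g e1) = 0" using g by (auto simp: block_triangular_def)
  have "?v = scale (s ?v f1) e1 + emb2 (co2 ?v)"
  proof -
    have "s e1 ?v = 0" using h by (simp only: block_triangular_def mem_Collect_eq)
    then show ?thesis using expansion2[of ?v] by simp
  qed
  then have "g ?v = g (scale (s ?v f1) e1 + emb2 (co2 ?v))" by (rule arg_cong)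
  then have "co2 (g ?v) = co2 (g (emb2 (co2 ?v)))"
    using gG by (simp add: Sp_linear co2_linear) (simp add: scale2_def zero_prod_def)
  then show "block2 (g \<circ> h) w = (block2 g \<circ> block2 h) w" by (simp add: block2_def)
qed

lemma Fix_e1_block_triangular: "g \<in> Fix e1 \<Longrightarrow> g \<in> block_triangular"
  using Sp_form[of g e1] by (auto simp: block_triangular_def Fix_iff)

lemma L2_emb2:
  assumes "g \<in> L2"
  shows "g (emb2 w) = emb2 (block2 g w)"
proof -
  have g: "g \<in> G" "g e1 = e1" "g f1 = f1" using assms by (auto simp: Fix_iff)
  show ?thesis
    using expansion2[of "g (emb2 w)"] Sp_form[OF g(1), of "emb2 w" f1] Sp_form[OF g(1), of e1 "emb2 w"] g
    by (simp add: block2_def)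
qed

lemma L1_emb2:
  assumes "g \<in> L1"
  shows "g (emb2 w) = emb2 w"
  using assms by (auto simp: Fix_iff emb2_def Sp_linear)

lemma L1_co2:
  assumes "g \<in> L1"
  shows "co2 (g e1) = 0" "co2 (g f1) = 0"
proof -
  have g: "g \<in> G" "g e2 = e2" "g f2 = f2" using assms by (auto simp: Fix_iff)
  show "co2 (g e1) = 0" "co2 (g f1) = 0"
    using Sp_form[OF g(1), of e1 f2] Sp_form[OF g(1), of e2 e1]
      Sp_form[OF g(1), of f1 f2] Sp_form[OF g(1), of e2 f1] g
    by (simp_all add: co2_def zero_prod_def)
qed

lemma L12_emb2:
  assumes "g1 \<in> L1" "g2 \<in> L2"
  shows "(g1 \<circ> g2) (emb2 w) = emb2 (block2 g2 w)"
  by (simp add: L2_emb2[OF assms(2)] L1_emb2[OF assms(1)])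

lemma L12_block_triangular:
  assumes "g \<in> L12"
  shows "g \<in> block_triangular"
proof -
  obtain g1 g2 where g: "g1 \<in> L1" "g2 \<in> L2" "g = g1 \<circ> g2"
    using assms by (auto simp: L12_def)
  have "g e1 = g1 e1" using g by (simp add: Fix_iff)
  then have "co2 (g e1) = 0" using L1_co2[OF g(1)] by simp
  moreover have "s e1 (g (emb2 w)) = 0" for w
    unfolding g(3) L12_emb2[OF g(1,2)] by simp
  ultimately show ?thesis using L12_Sp[OF assms] by (simp add: block_triangular_def)
qed

lemma L12_emb2':
  assumes "g \<in> L12"
  shows "g (emb2 w) = emb2 (block2 g w)"
proof -
  obtain g1 g2 where g: "g1 \<in> L1" "g2 \<in> L2" "g = g1 \<circ> g2"
    using assms by (auto simp: L12_def)
  show ?thesis using L12_emb2[OF g(1,2)] unfolding g(3) block2_def[of "g1 \<circ> g2"] by simp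
qed

text \<open>
  Heisenberg coordinates \<open>(t, n)\<close> of \<open>g \<in> Fix e1\<close> from \<open>g f1 = t e1 + f1 + n\<close>, together with the block of \<open>g\<close>.
\<close>

definition Q_iso :: "('v \<Rightarrow> 'v) \<Rightarrow> ('f \<times> 'f \<times> 'f) \<times> ('f \<times> 'f \<Rightarrow> 'f \<times> 'f)"
  where "Q_iso g = ((s (g f1) f1, co2 (g f1)), block2 g)"

lemma Fix_e1_f1:
  assumes "g \<in> Fix e1"
  shows "g f1 = scale (s (g f1) f1) e1 + f1 + emb2 (co2 (g f1))"
proof -
  have g: "g \<in> G" "g e1 = e1" using assms by (auto simp: Fix_iff)
  then show ?thesis using expansion2[of "g f1"] Sp_form[OF g(1), of e1 f1] by simp
qed

text \<open>
  The coefficient of \<open>e1\<close> is forced by the orthogonality of \<open>g (emb2 w)\<close> and \<open>g f1\<close>. It produces the term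
  \<open>form2\<close> of the Heisenberg law.
\<close>

lemma Fix_e1_emb2:
  assumes "g \<in> Fix e1"
  shows "g (emb2 w) = scale (form2 (co2 (g f1)) (block2 g w)) e1 + emb2 (block2 g w)"
proof -
  have g: "g \<in> G" "g e1 = e1" using assms by (auto simp: Fix_iff)
  have 0: "s e1 (g (emb2 w)) = 0" "s e1 (g f1) = 1"
    using Sp_form[OF g(1), of e1 "emb2 w"] Sp_form[OF g(1), of e1 f1] g by simp_all
  have "s (g (emb2 w)) (g f1) = 0" using Sp_form[OF g(1), of "emb2 w" f1] by simp
  then have "s (g (emb2 w)) f1 = - form2 (co2 (g (emb2 w))) (co2 (g f1))"
    using form_expansion2[of "g (emb2 w)" "g f1"] 0 by (simp add: eq_neg_iff_add_eq_0)
  also have "\<dots> = form2 (co2 (g f1)) (co2 (g (emb2 w)))" by (simp add: form2_def)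
  finally show ?thesis using expansion2[of "g (emb2 w)"] 0 by (simp add: block2_def)
qed

lemma Q_iso_hom:
  assumes g: "g \<in> Fix e1" and h: "h \<in> Fix e1"
  shows "Q_iso (g \<circ> h) = Q_iso g \<otimes>\<^bsub>semidirect_product heis3 Sp2 heis3_action\<^esub> Q_iso h"
proof -
  have gG: "g \<in> G" "g e1 = e1" using g by (auto simp: Fix_iff)
  have hf: "h f1 = scale (s (h f1) f1) e1 + f1 + emb2 (co2 (h f1))" using Fix_e1_f1[OF h] .
  let ?n = "co2 (g f1)" and ?b = "block2 g (co2 (h f1))"
  have "g (h f1) = g (scale (s (h f1) f1) e1 + f1 + emb2 (co2 (h f1)))" using hf by simp
  also have "\<dots> = scale (s (h f1) f1) e1 + g f1 + (scale (form2 ?n ?b) e1 + emb2 ?b)"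
    using gG by (simp add: Sp_linear Fix_e1_emb2[OF g])
  finally have *: "g (h f1) = scale (s (h f1) f1) e1 + g f1 + (scale (form2 ?n ?b) e1 + emb2 ?b)" .
  have "s (g (h f1)) f1 = s (h f1) f1 + s (g f1) f1 + form2 ?n ?b"
    unfolding * by simp
  moreover have "co2 (g (h f1)) = ?n + ?b"
    unfolding * by (simp add: co2_linear) (simp add: scale2_def zero_prod_def)
  ultimately show ?thesis
    using block2_comp[OF Fix_e1_block_triangular[OF g] Fix_e1_block_triangular[OF h]]
    by (simp add: Q_iso_def semidirect_product_def heis3_def heis3_action_def algebra_simps)
qed

lemma Q_iso_inj: "inj_on Q_iso (Fix e1)"
proof (rule inj_onI)
  fix g h assume g: "g \<in> Fix e1" and h: "h \<in> Fix e1" and eq: "Q_iso g = Q_iso h"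
  have "s (g f1) f1 = s (h f1) f1" "co2 (g f1) = co2 (h f1)" "block2 g = block2 h"
    using eq by (simp_all add: Q_iso_def)
  then have f: "g f1 = h f1" and "g (emb2 w) = h (emb2 w)" for w
    using Fix_e1_f1[OF g] Fix_e1_f1[OF h] Fix_e1_emb2[OF g] Fix_e1_emb2[OF h] by simp_all
  from this(2)[of "(1, 0)"] this(2)[of "(0, 1)"] have "g e2 = h e2" "g f2 = h f2" by simp_all
  then show "g = h" using g h f by (intro Sp_eqI) (simp_all add: Fix_iff)
qed

lemma Q_iso_surj:
  assumes h: "h \<in> carrier Sp2"
  shows "\<exists>g\<in>Fix e1. Q_iso g = ((t, n), h)"
proof
  let ?E = "\<lambda>w. scale (form2 n (h w)) e1 + emb2 (h w)"
  let ?g = "lin_map e1 (scale t e1 + f1 + emb2 n) (?E (1, 0)) (?E (0, 1))"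
  have "?g \<in> G"
    by (rule lin_map_in_Sp) (simp_all add: form2_basis[OF h])
  then show g: "?g \<in> Fix e1" by (simp add: Fix_iff)
  have f1: "s (?g f1) f1 = t" "co2 (?g f1) = n"
    by (simp_all add: co2_linear) (simp add: scale2_def zero_prod_def)
  have co: "co2 (?E w) = h w" for w
    by (simp add: co2_linear) (simp add: scale2_def zero_prod_def)
  have "block2 ?g = h"
    by (rule Sp2_eqI[OF block2_Sp2[OF Fix_e1_block_triangular[OF g]] h]) (simp_all add: block2_def co)
  then show "Q_iso ?g = ((t, n), h)" using f1 by (simp add: Q_iso_def)
qed

lemma Q_iso_iso:
  "Q_iso \<in> iso ((Sp scale s)\<lparr>carrier := Fix e1\<rparr>) (semidirect_product heis3 Sp2 heis3_action)"
proof (rule isoI)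
  show "Q_iso \<in> hom ((Sp scale s)\<lparr>carrier := Fix e1\<rparr>) (semidirect_product heis3 Sp2 heis3_action)"
  proof (rule homI)
    show "Q_iso g \<in> carrier (semidirect_product heis3 Sp2 heis3_action)"
      if "g \<in> carrier ((Sp scale s)\<lparr>carrier := Fix e1\<rparr>)" for g
      using that block2_Sp2[OF Fix_e1_block_triangular, of g]
      by (simp add: Q_iso_def semidirect_product_def heis3_def)
  qed (simp add: Q_iso_hom)
  have "Q_iso ` Fix e1 = carrier (semidirect_product heis3 Sp2 heis3_action)"
  proof (intro equalityI subsetI)
    fix x assume "x \<in> Q_iso ` Fix e1"
    then show "x \<in> carrier (semidirect_product heis3 Sp2 heis3_action)"
      using block2_Sp2[OF Fix_e1_block_triangular] by (auto simp: Q_iso_def semidirect_product_def heis3_def)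
  next
    fix x :: "('f \<times> 'f \<times> 'f) \<times> ('f \<times> 'f \<Rightarrow> 'f \<times> 'f)"
    assume "x \<in> carrier (semidirect_product heis3 Sp2 heis3_action)"
    moreover obtain t n h where "x = ((t, n), h)" by (metis surj_pair)
    ultimately show "x \<in> Q_iso ` Fix e1"
      using Q_iso_surj[of h t n] by (force simp: semidirect_product_def)
  qed
  then show "bij_betw Q_iso (carrier ((Sp scale s)\<lparr>carrier := Fix e1\<rparr>))
      (carrier (semidirect_product heis3 Sp2 heis3_action))"
    using Q_iso_inj by (simp add: bij_betw_def)
qed

abbreviation block1 :: "('v \<Rightarrow> 'v) \<Rightarrow> 'f \<times> 'f \<Rightarrow> 'f \<times> 'f"
  where "block1 \<equiv> symplectic_space_4.block2 scale s e1 f1"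

lemma L12_swap: "symplectic_space_4.L12 scale s e2 f2 e1 f1 = L12"
  unfolding symplectic_space_4.generate_L12[OF swap, symmetric] generate_L12[symmetric]
  by (simp add: Un_commute)

lemma block1_basis:
  "block1 g (1, 0) = (s (g e1) f1, s e1 (g e1))" "block1 g (0, 1) = (s (g f1) f1, s e1 (g f1))"
  by (simp_all add: symplectic_space_4.block2_def[OF swap] symplectic_space_4.co2_def[OF swap]
      symplectic_space_4.emb2_basis[OF swap])

lemma block2_basis:
  "block2 g (1, 0) = (s (g e2) f2, s e2 (g e2))" "block2 g (0, 1) = (s (g f2) f2, s e2 (g f2))"
  by (simp_all add: block2_def co2_def)

definition S_iso :: "('v \<Rightarrow> 'v) \<Rightarrow> ('f \<times> 'f \<Rightarrow> 'f \<times> 'f) \<times> ('f \<times> 'f \<Rightarrow> 'f \<times> 'f)"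
  where "S_iso g = (block1 g, block2 g)"

lemma S_iso_iso: "S_iso \<in> iso ((Sp scale s)\<lparr>carrier := L12\<rparr>) (Sp2 \<times>\<times> Sp2)"
proof (rule isoI)
  note sw = symplectic_space_4.block2_Sp2[OF swap] symplectic_space_4.block2_comp[OF swap]
    symplectic_space_4.L12_block_triangular[OF swap, unfolded L12_swap]
  have closed: "S_iso g \<in> carrier (Sp2 \<times>\<times> Sp2)" if "g \<in> L12" for g
    using that sw block2_Sp2 L12_block_triangular by (simp add: S_iso_def DirProd_def)
  show "S_iso \<in> hom ((Sp scale s)\<lparr>carrier := L12\<rparr>) (Sp2 \<times>\<times> Sp2)"
    by (rule homI) (use closed in \<open>simp_all add: S_iso_def sw block2_comp L12_block_triangular\<close>)
  have "inj_on S_iso L12"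
  proof (rule inj_onI)
    fix g h assume g: "g \<in> L12" and h: "h \<in> L12" and eq: "S_iso g = S_iso h"
    note e = symplectic_space_4.L12_emb2'[OF swap, unfolded L12_swap]
    note basis = symplectic_space_4.emb2_basis[OF swap]
    show "g = h"
    proof (rule Sp_eqI)
      show "g e1 = h e1" using e[OF g, of "(1, 0)"] e[OF h, of "(1, 0)"] eq basis by (simp add: S_iso_def)
      show "g f1 = h f1" using e[OF g, of "(0, 1)"] e[OF h, of "(0, 1)"] eq basis by (simp add: S_iso_def)
      show "g e2 = h e2" using L12_emb2'[OF g, of "(1, 0)"] L12_emb2'[OF h, of "(1, 0)"] eq by (simp add: S_iso_def)
      show "g f2 = h f2" using L12_emb2'[OF g, of "(0, 1)"] L12_emb2'[OF h, of "(0, 1)"] eq by (simp add: S_iso_def)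
    qed (use g h L12_Sp in auto)
  qed
  moreover have "S_iso ` L12 = carrier (Sp2 \<times>\<times> Sp2)"
  proof (intro equalityI subsetI)
    show "x \<in> carrier (Sp2 \<times>\<times> Sp2)" if "x \<in> S_iso ` L12" for x using that closed by auto
    fix x :: "('f \<times> 'f \<Rightarrow> 'f \<times> 'f) \<times> ('f \<times> 'f \<Rightarrow> 'f \<times> 'f)"
    assume "x \<in> carrier (Sp2 \<times>\<times> Sp2)"
    then obtain h1 h2 where h: "h1 \<in> carrier Sp2" "h2 \<in> carrier Sp2" and x: "x = (h1, h2)"
      by (auto simp: DirProd_def)
    obtain g1 where g1: "g1 \<in> L1"
        "g1 e1 = scale (fst (h1 (1, 0))) e1 + scale (snd (h1 (1, 0))) f1"
        "g1 f1 = scale (fst (h1 (0, 1))) e1 + scale (snd (h1 (0, 1))) f1"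
      using ex_L1 form2_basis[OF h(1)] unfolding form2_def by metis
    obtain g2 where g2: "g2 \<in> L2"
        "g2 e2 = scale (fst (h2 (1, 0))) e2 + scale (snd (h2 (1, 0))) f2"
        "g2 f2 = scale (fst (h2 (0, 1))) e2 + scale (snd (h2 (0, 1))) f2"
      using symplectic_space_4.ex_L1[OF swap] form2_basis[OF h(2)] unfolding form2_def by metis
    let ?g = "g1 \<circ> g2"
    have g: "?g \<in> L12" using g1 g2 by (intro L12_I)
    have "?g e1 = g1 e1" "?g f1 = g1 f1" using g2 by (auto simp: Fix_iff)
    moreover have "?g e2 = g2 e2" "?g f2 = g2 f2"
      using g1 g2 by (auto simp: Fix_iff Sp_linear)
    ultimately have "block1 ?g = h1" "block2 ?g = h2"
      using g1 g2 h sw block2_Sp2 L12_block_triangular g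
      by (intro Sp2_eqI; simp add: block1_basis block2_basis del: comp_apply)+
    then have "S_iso ?g = x" by (simp add: S_iso_def x)
    then show "x \<in> S_iso ` L12" using g by blast
  qed
  ultimately show "bij_betw S_iso (carrier ((Sp scale s)\<lparr>carrier := L12\<rparr>)) (carrier (Sp2 \<times>\<times> Sp2))"
    by (simp add: bij_betw_def)
qed

text \<open>
  The subgroup \<open>H\<close> contains the stabilizer of \<open>e2\<close>, and it moves \<open>e2\<close> to every nonzero vector: inside \<open>\<langle>e2, f2\<rangle>\<close> by
  \<open>L2\<close>, and otherwise by a shear, or by two shears, followed by \<open>L12\<close>.
\<close>

lemma Sp_covered:
  assumes H: "subgroup H (Sp scale s)" "L12 \<union> Fix e1 \<union> Fix e2 \<subseteq> H"
  shows "G \<subseteq> H"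
proof
  fix g assume g: "g \<in> G"
  have comp: "h \<circ> k \<in> H" if "h \<in> H" "k \<in> H" for h k
    using subgroup.m_closed[OF H(1) that] by simp
  define a1 where "a1 = s (g e2) f1"
  define b1 where "b1 = s e1 (g e2)"
  define a2 where "a2 = s (g e2) f2"
  define b2 where "b2 = s e2 (g e2)"
  have v: "g e2 = scale a1 e1 + scale b1 f1 + (scale a2 e2 + scale b2 f2)"
    using basis_expansion[of "g e2"] by (simp add: a1_def b1_def a2_def b2_def add.assoc)
  have mH: "shear21 \<in> H" and yH: "finv shear12 \<in> H"
    using H(2) Fix_inv[of shear12 e2] by (auto simp: Fix_iff)
  have y: "finv shear12 (e2 + e1) = e1" by (simp add: Sp_inv_eq_iff add.commute)
  have "\<exists>r\<in>H. r e2 = g e2"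
  proof -
    consider "a1 = 0 \<and> b1 = 0" | "a2 = 0 \<and> b2 = 0" "a1 \<noteq> 0 \<or> b1 \<noteq> 0"
      | "a1 \<noteq> 0 \<or> b1 \<noteq> 0" "a2 \<noteq> 0 \<or> b2 \<noteq> 0" by blast
    then show ?thesis
    proof cases
      case 1
      have "a2 \<noteq> 0 \<or> b2 \<noteq> 0"
      proof (rule ccontr)
        assume "\<not> ?thesis"
        then have "g e2 = g 0" using v 1 g by (simp add: Sp_zero)
        then have "e2 = 0" using Sp_inj g by blast
        then have "s e2 f2 = 0" by (metis form_zero(1))
        then show False by simp
      qed
      then obtain h where "h \<in> L2" "h e2 = scale a2 e2 + scale b2 f2"
        using symplectic_space_4.L1_transitive[OF swap] by blast
      then show ?thesis using v 1 H(2) L2_sub_L12 by (intro bexI[of _ h]) auto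
    next
      case 2
      then obtain h where h: "h \<in> L1" "h e1 = scale a1 e1 + scale b1 f1"
        using L1_transitive by blast
      have "(h \<circ> (finv shear12 \<circ> shear21)) e2 = g e2" using h v 2 y by simp
      moreover have "h \<circ> (finv shear12 \<circ> shear21) \<in> H"
        using h H(2) L1_sub_L12 by (intro comp mH yH) auto
      ultimately show ?thesis by blast
    next
      case 3
      then obtain h1 h2 where h1: "h1 \<in> L1" "h1 e1 = scale a1 e1 + scale b1 f1"
        and h2: "h2 \<in> L2" "h2 e2 = scale a2 e2 + scale b2 f2"
        using L1_transitive symplectic_space_4.L1_transitive[OF swap] by metis
      have "h1 e2 = e2" "h1 f2 = f2" "h2 e1 = e1" "h1 \<in> G" "h2 \<in> G"
        using h1 h2 by (auto simp: Fix_iff)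
      then have "((h1 \<circ> h2) \<circ> shear21) e2 = g e2"
        using h1 h2 v by (simp add: Sp_linear algebra_simps)
      moreover have "(h1 \<circ> h2) \<circ> shear21 \<in> H"
        using L12_I[OF h1(1) h2(1)] H(2) by (intro comp[OF _ mH]) auto
      ultimately show ?thesis by blast
    qed
  qed
  then obtain r where r: "r \<in> H" "r e2 = g e2" by blast
  have rG: "r \<in> G" using subgroup.subset[OF H(1)] r by blast
  have "finv r \<circ> g \<in> Fix e2"
    using rG g r(2)[symmetric] by (simp add: Fix_iff Sp_comp_closed Sp_inv_closed Sp_inv_left)
  then have "r \<circ> (finv r \<circ> g) \<in> H" using comp r H(2) by blast
  also have "r \<circ> (finv r \<circ> g) = g" using rG by (auto simp: Sp_inv_right)
  finally show "g \<in> H" .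
qed

section \<open>The universal completion of the amalgam\<close>

abbreviation A :: "amalgam_index \<Rightarrow> ('v \<Rightarrow> 'v) monoid"
  where "A \<equiv> amalgam_group scale s e1 f1 e2 f2"

lemma amalgam_set_eq:
  "amalgam_set scale s e1 f1 e2 f2 S1 = L1"
  "amalgam_set scale s e1 f1 e2 f2 S2 = L2"
  "amalgam_set scale s e1 f1 e2 f2 M1 = M"
  "amalgam_set scale s e1 f1 e2 f2 S12 = L12"
  "amalgam_set scale s e1 f1 e2 f2 Q11 = Fix e2"
  "amalgam_set scale s e1 f1 e2 f2 Q12 = Fix e1"
  by (simp_all add: amalgam_set.simps S_set_eq symplectic_space_4.S_set_eq[OF swap] M_set_eq generate_L12
      generate_Fix_e1 generate_Fix_e2)

declare amalgam_set.simps [simp del]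

lemma subgroup_amalgam_set: "subgroup (amalgam_set scale s e1 f1 e2 f2 i) (Sp scale s)"
  by (cases i) (simp_all only: amalgam_set_eq subgroup_L12 subgroup_Fix
      group.subgroups_Inter_pair[OF group_Sp])

lemma carrier_A [simp]: "carrier (A i) = amalgam_set scale s e1 f1 e2 f2 i"
  by (simp add: amalgam_group_def)

lemma diagram_amalgam:
  "diagram_cocone (Sp scale s) (\<lambda>i g. g) UNIV A amalgam_arrows (\<lambda>i j g. g)"
proof (intro diagram_cocone.intro diagram_cocone_axioms.intro group_Sp)
  show "group (A i)" for i
    unfolding amalgam_group_def
    by (rule subgroup.subgroup_is_group[OF subgroup_amalgam_set group_Sp])
  show "(\<lambda>g. g) \<in> hom (A i) (Sp scale s)" for i
    using subgroup.subset[OF subgroup_amalgam_set[of i]]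
    by (intro homI) (auto simp: amalgam_group_def)
  show "x \<in> carrier (A j)" if "(i, j) \<in> amalgam_arrows" "x \<in> carrier (A i)" for i j x
    using that L1_sub_L12[of x] L2_sub_L12[of x]
    by (auto simp: amalgam_arrows_def amalgam_set_eq)
qed simp_all

text \<open>
  Every generator of the completion belongs to one of the three large members, all of which preserve the union of
  the double cosets; so this union is everything, and the kernel of the canonical map is trivial.
\<close>

lemma universal_completion_Sp:
  "is_universal_completion (Sp scale s) (\<lambda>i g. g) UNIV A amalgam_arrows (\<lambda>i j g. g)"
proof -
  interpret D: diagram_cocone "Sp scale s" "\<lambda>i g. g" UNIV A amalgam_arrows "\<lambda>i j g. g"
    by (rule diagram_amalgam)
  interpret S: group "Sp scale s" by (rule group_Sp)
  interpret U: group D.U by (rule D.group_U)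
  let ?\<pi> = "canonical_map (Sp scale s) (\<lambda>(i::amalgam_index) g. g)"
  interpret \<pi>: group_hom D.U "Sp scale s" ?\<pi> by unfold_locales (rule D.canonical_map_hom)
  note set_eq = amalgam_set_eq
  have arrow: "D.generator j g = D.generator i g" if "(i, j) \<in> amalgam_arrows" "g \<in> carrier (A i)" for i j g
    using D.generator_\<phi>[OF that] .
  have hom: "D.generator i (g \<circ> h) = D.generator i g \<otimes>\<^bsub>D.U\<^esub> D.generator i h"
    if "g \<in> carrier (A i)" "h \<in> carrier (A i)" for i g h
    using hom_mult[OF D.generator_hom[of i] that] by (simp add: amalgam_group_def)
  interpret C: amalgam_cocone scale s e1 f1 e2 f2 D.U
    "D.generator S12" "D.generator Q11" "D.generator Q12"
  proof unfold_locales
    fix g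
    show "D.generator S12 g = D.generator Q11 g" if "g \<in> L1"
      using arrow[of S1 S12 g] arrow[of S1 Q11 g] that
      by (simp add: amalgam_arrows_def set_eq)
    show "D.generator S12 g = D.generator Q12 g" if "g \<in> L2"
      using arrow[of S2 S12 g] arrow[of S2 Q12 g] that
      by (simp add: amalgam_arrows_def set_eq)
    show "D.generator Q11 g = D.generator Q12 g" if "g \<in> M"
      using arrow[of M1 Q11 g] arrow[of M1 Q12 g] that
      by (simp add: amalgam_arrows_def set_eq)
  qed (simp_all add: hom D.generator_closed set_eq)
  have sec: "?\<pi> (D.generator i g) = g" if "g \<in> carrier (A i)" for i g
    using D.canonical_map_generator[of i g] that by simp
  have all: "p \<in> C.cosets" if "p \<in> carrier D.U" for p
    using that
  proof (induction rule: D.universal_completion_induct)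
    case one
    show ?case by (rule C.cosets_one)
  next
    case (mult i x p)
    have "\<exists>j \<in> {S12, Q11, Q12}. D.generator i x = D.generator j x \<and> x \<in> carrier (A j)"
    proof (cases i)
      case S1
      then show ?thesis using arrow[of S1 Q11 x] mult(2)
        by (simp add: amalgam_arrows_def set_eq)
    next
      case S2
      then show ?thesis using arrow[of S2 Q12 x] mult(2)
        by (simp add: amalgam_arrows_def set_eq)
    next
      case M1
      then show ?thesis using arrow[of M1 Q12 x] mult(2)
        by (simp add: amalgam_arrows_def set_eq)
    qed (use mult(2) in auto)
    then show ?case using C.mult_cosets'[of x p] mult(4) by (auto simp: set_eq)
  qed
  have ker: "p = \<one>\<^bsub>D.U\<^esub>" if "p \<in> carrier D.U" "?\<pi> p = id" for p
    by (rule C.kernel_trivial[OF D.canonical_map_hom _ _ _ all[OF that(1)] that(2)])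
      (simp_all add: sec set_eq)
  have "inj_on ?\<pi> (carrier D.U)"
    by (rule \<pi>.inj_on_one_iff[THEN iffD2]) (use ker in auto)
  moreover have "G \<subseteq> ?\<pi> ` carrier D.U"
  proof (rule Sp_covered)
    show "subgroup (?\<pi> ` carrier D.U) (Sp scale s)" by (rule \<pi>.img_is_subgroup)
    have "g \<in> ?\<pi> ` carrier D.U" if "g \<in> carrier (A i)" for g i
      using sec[OF that] D.generator_closed[of i g] that by (metis UNIV_I imageI)
    from this[of _ S12] this[of _ Q11] this[of _ Q12]
    show "L12 \<union> Fix e1 \<union> Fix e2 \<subseteq> ?\<pi> ` carrier D.U" by (auto simp: set_eq)
  qed
  ultimately show ?thesis
    unfolding is_universal_completion_def
    using D.canonical_map_hom by (auto simp: iso_def bij_betw_def hom_def Pi_iff)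
qed

end

theorem corollary1p2:
  fixes scale :: "'f::field \<Rightarrow> 'v::ab_group_add \<Rightarrow> 'v"
    and s :: "'v \<Rightarrow> 'v \<Rightarrow> 'f"
    and e1 f1 e2 f2 :: 'v
  assumes "symplectic_space_4 scale s e1 f1 e2 f2"
  shows "is_universal_completion (Sp scale s) (\<lambda>i g. g)
           {S1, S2, M1, S12, Q11, Q12} (amalgam_group scale s e1 f1 e2 f2)
           amalgam_arrows (\<lambda>i j g. g)
    \<and> amalgam_group scale s e1 f1 e2 f2 S12 \<cong> (Sp2 :: ('f \<times> 'f \<Rightarrow> 'f \<times> 'f) monoid) \<times>\<times> (Sp2 :: ('f \<times> 'f \<Rightarrow> 'f \<times> 'f) monoid)
    \<and> amalgam_group scale s e1 f1 e2 f2 Q11 \<cong> amalgam_group scale s e1 f1 e2 f2 Q12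
    \<and> amalgam_group scale s e1 f1 e2 f2 Q12 \<cong>
        semidirect_product (heis3 :: ('f \<times> 'f \<times> 'f) monoid) Sp2 heis3_action"
proof -
  interpret V: symplectic_space_4 scale s e1 f1 e2 f2 by (rule assms)
  note sw = V.swap
  have I: "{S1, S2, M1, S12, Q11, Q12} = UNIV"
    by (auto intro: amalgam_index.exhaust)
  have gr: "V.A i = (Sp scale s)\<lparr>carrier := amalgam_set scale s e1 f1 e2 f2 i\<rparr>" for i
    by (simp add: amalgam_group_def)
  have 1: "V.A S12 \<cong> (Sp2 :: ('f \<times> 'f \<Rightarrow> 'f \<times> 'f) monoid) \<times>\<times> (Sp2 :: ('f \<times> 'f \<Rightarrow> 'f \<times> 'f) monoid)"
    using V.S_iso_iso unfolding gr V.amalgam_set_eq by (rule is_isoI)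
  have 2: "V.A Q12 \<cong> semidirect_product (heis3 :: ('f \<times> 'f \<times> 'f) monoid) Sp2 heis3_action"
    using V.Q_iso_iso unfolding gr V.amalgam_set_eq by (rule is_isoI)
  \<comment> \<open>Exchanging the two hyperbolic pairs turns \<open>Q\<^sub>1\<^sub>2\<close> into \<open>Q\<^sub>1\<^sub>1\<close>.\<close>
  have 3: "V.A Q11 \<cong> semidirect_product (heis3 :: ('f \<times> 'f \<times> 'f) monoid) Sp2 heis3_action"
    using symplectic_space_4.Q_iso_iso[OF sw] unfolding gr V.amalgam_set_eq by (rule is_isoI)
  have "group (V.A Q12)"
    using V.diagram_amalgam by (simp add: diagram_cocone_def diagram_cocone_axioms_def)
  then have "V.A Q11 \<cong> V.A Q12"
    using iso_trans[OF 3 group.iso_sym[OF _ 2]] by blast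
  then show ?thesis using 1 2 V.universal_completion_Sp unfolding I by blast
qed

end
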